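(* The following assertions hold for functors between categories. (1) If a coreflection up to retracts has a left adjoint, then it is a coreflection. (2) If a coreflection up to retracts has a right adjoint, then it is a reflection. (3) If a reflection up to retracts has a right adjoint, then it is a reflection. (4) If a reflection up to retracts has a left adjoint, then it is a coreflection. (5) If a bireflection up to retracts has an adjoint (left or right), then it is a bireflection. (6) If an equivalence up to retracts has an adjoint (left or right), then it is an equivalence.
   Context: The idempotent completion $\mathcal{C}^\natural$ of a category $\mathcal{C}$ has as objects the pairs $(X,e)$ with $X$ an object of $\mathcal{C}$ and $e:X\to X$ idempotent; a morphism $f:(X,e)\to(X',e')$ is a morphism $f:X\to X'$ in $\mathcal{C}$ with $f=e'\circ f\circ e$; composition is that of $\mathcal{C}$ and $\mathrm{Id}_{(X,e)}=e$. A functor $F:\mathcal{C}\to\mathcal{D}$ induces its completion $F^\natural:\mathcal{C}^\natural\to\mathcal{D}^\natural$, $F^\natural(X,e)=(FX,Fe)$, $F^\natural(f)=F(f)$. A reflection is a functor admitting a fully faithful right adjoint. A coreflection is a functor admitting a fully faithful left adjoint. A bireflection is a functor $G:\mathcal{D}\to\mathcal{C}$ having a fully faithful functor $F:\mathcal{C}\to\mathcal{D}$ which is both a left and a right adjoint of $G$ and such that $\eta^r\circ\epsilon^l=\mathrm{Id}_{FG}$, where $\epsilon^l:FG\to\mathrm{Id}_{\mathcal{D}}$ is the counit of $F\dashv G$ and $\eta^r:\mathrm{Id}_{\mathcal{D}}\to FG$ is the unit of $G\dashv F$. A functor $F$ is a reflection (resp. coreflection, bireflection, equivalence) up to retracts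 if $F^\natural$ is a reflection (resp. coreflection, bireflection, equivalence). *)

theory Defs
  imports Main
begin

section \<open>Categories and functors\<close>

text \<open>
  A category is given by a set of objects and a family of hom-sets. The hom-sets are not required
  to be disjoint (in an idempotent completion they are not), so composition carries the three
  objects involved: \<open>Comp C X Y Z g f\<close> is the composite \<open>g \<circ> f\<close> of \<open>f : X \<rightarrow> Y\<close> and \<open>g : Y \<rightarrow> Z\<close>.
  For the same reason the action of a functor on morphisms carries the source and the target.
  Values outside the objects and hom-sets are irrelevant throughout.
\<close>

record ('o, 'm) cat =
  Obj :: "'o set"
  Hom :: "'o \<Rightarrow> 'o \<Rightarrow> 'm set"
  Comp :: "'o \<Rightarrow> 'o \<Rightarrow> 'o \<Rightarrow> 'm \<Rightarrow> 'm \<Rightarrow> 'm"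
  Ident :: "'o \<Rightarrow> 'm"

locale category =
  fixes C :: "('o, 'm) cat"
  assumes Ident_in_Hom: "X \<in> Obj C \<Longrightarrow> Ident C X \<in> Hom C X X"
    and Comp_in_Hom:
      "\<lbrakk>X \<in> Obj C; Y \<in> Obj C; Z \<in> Obj C; f \<in> Hom C X Y; g \<in> Hom C Y Z\<rbrakk>
        \<Longrightarrow> Comp C X Y Z g f \<in> Hom C X Z"
    and Comp_Ident_right:
      "\<lbrakk>X \<in> Obj C; Y \<in> Obj C; f \<in> Hom C X Y\<rbrakk> \<Longrightarrow> Comp C X X Y f (Ident C X) = f"
    and Comp_Ident_left:
      "\<lbrakk>X \<in> Obj C; Y \<in> Obj C; f \<in> Hom C X Y\<rbrakk> \<Longrightarrow> Comp C X Y Y (Ident C Y) f = f"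
    and Comp_assoc:
      "\<lbrakk>W \<in> Obj C; X \<in> Obj C; Y \<in> Obj C; Z \<in> Obj C;
        f \<in> Hom C W X; g \<in> Hom C X Y; h \<in> Hom C Y Z\<rbrakk>
        \<Longrightarrow> Comp C W Y Z h (Comp C W X Y g f) = Comp C W X Z (Comp C X Y Z h g) f"

record ('o, 'm, 'p, 'n) func =
  fobj :: "'o \<Rightarrow> 'p"
  fmor :: "'o \<Rightarrow> 'o \<Rightarrow> 'm \<Rightarrow> 'n"

locale cat_functor = source: category C + target: category D
  for C :: "('o, 'm) cat" and D :: "('p, 'n) cat" +
  fixes F :: "('o, 'm, 'p, 'n) func"
  assumes fobj_in_Obj: "X \<in> Obj C \<Longrightarrow> fobj F X \<in> Obj D"
    and fmor_in_Hom:
      "\<lbrakk>X \<in> Obj C; Y \<in> Obj C; f \<in> Hom C X Y\<rbrakk> \<Longrightarrow> fmor F X Y f \<in> Hom D (fobj F X) (fobj F Y)"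
    and fmor_Ident: "X \<in> Obj C \<Longrightarrow> fmor F X X (Ident C X) = Ident D (fobj F X)"
    and fmor_Comp:
      "\<lbrakk>X \<in> Obj C; Y \<in> Obj C; Z \<in> Obj C; f \<in> Hom C X Y; g \<in> Hom C Y Z\<rbrakk>
        \<Longrightarrow> fmor F X Z (Comp C X Y Z g f) =
            Comp D (fobj F X) (fobj F Y) (fobj F Z) (fmor F Y Z g) (fmor F X Y f)"

definition id_func :: "('o, 'm, 'o, 'm) func" where
  "id_func = \<lparr>fobj = (\<lambda>X. X), fmor = (\<lambda>X Y f. f)\<rparr>"

definition comp_func ::
  "('p, 'n, 'q, 'k) func \<Rightarrow> ('o, 'm, 'p, 'n) func \<Rightarrow> ('o, 'm, 'q, 'k) func" where
  "comp_func G F =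
    \<lparr>fobj = (\<lambda>X. fobj G (fobj F X)),
     fmor = (\<lambda>X Y f. fmor G (fobj F X) (fobj F Y) (fmor F X Y f))\<rparr>"

definition fully_faithful ::
  "('o, 'm) cat \<Rightarrow> ('p, 'n) cat \<Rightarrow> ('o, 'm, 'p, 'n) func \<Rightarrow> bool" where
  "fully_faithful C D F \<longleftrightarrow> cat_functor C D F \<and>
    (\<forall>X\<in>Obj C. \<forall>Y\<in>Obj C. bij_betw (fmor F X Y) (Hom C X Y) (Hom D (fobj F X) (fobj F Y)))"

definition nat_trans ::
  "('o, 'm) cat \<Rightarrow> ('p, 'n) cat \<Rightarrow> ('o, 'm, 'p, 'n) func \<Rightarrow> ('o, 'm, 'p, 'n) func
    \<Rightarrow> ('o \<Rightarrow> 'n) \<Rightarrow> bool" where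
  "nat_trans C D F G \<tau> \<longleftrightarrow> cat_functor C D F \<and> cat_functor C D G \<and>
    (\<forall>X\<in>Obj C. \<tau> X \<in> Hom D (fobj F X) (fobj G X)) \<and>
    (\<forall>X\<in>Obj C. \<forall>Y\<in>Obj C. \<forall>f\<in>Hom C X Y.
      Comp D (fobj F X) (fobj F Y) (fobj G Y) (\<tau> Y) (fmor F X Y f) =
      Comp D (fobj F X) (fobj G X) (fobj G Y) (fmor G X Y f) (\<tau> X))"

definition is_iso :: "('o, 'm) cat \<Rightarrow> 'o \<Rightarrow> 'o \<Rightarrow> 'm \<Rightarrow> bool" where
  "is_iso C X Y f \<longleftrightarrow> f \<in> Hom C X Y \<and>
    (\<exists>g\<in>Hom C Y X. Comp C X Y X g f = Ident C X \<and> Comp C Y X Y f g = Ident C Y)"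

definition nat_iso ::
  "('o, 'm) cat \<Rightarrow> ('p, 'n) cat \<Rightarrow> ('o, 'm, 'p, 'n) func \<Rightarrow> ('o, 'm, 'p, 'n) func
    \<Rightarrow> ('o \<Rightarrow> 'n) \<Rightarrow> bool" where
  "nat_iso C D F G \<tau> \<longleftrightarrow> nat_trans C D F G \<tau> \<and>
    (\<forall>X\<in>Obj C. is_iso D (fobj F X) (fobj G X) (\<tau> X))"


section \<open>Adjunctions\<close>

text \<open>\<open>adjunction C D L R \<eta> \<epsilon>\<close>: the functor \<open>L : C \<rightarrow> D\<close> is left adjoint to \<open>R : D \<rightarrow> C\<close>, with unit
  \<open>\<eta> : Id \<rightarrow> RL\<close> and counit \<open>\<epsilon> : LR \<rightarrow> Id\<close> satisfying the triangle identities.\<close>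

definition adjunction ::
  "('o, 'm) cat \<Rightarrow> ('p, 'n) cat \<Rightarrow> ('o, 'm, 'p, 'n) func \<Rightarrow> ('p, 'n, 'o, 'm) func
    \<Rightarrow> ('o \<Rightarrow> 'm) \<Rightarrow> ('p \<Rightarrow> 'n) \<Rightarrow> bool" where
  "adjunction C D L R \<eta> \<epsilon> \<longleftrightarrow>
    cat_functor C D L \<and> cat_functor D C R \<and>
    nat_trans C C id_func (comp_func R L) \<eta> \<and>
    nat_trans D D (comp_func L R) id_func \<epsilon> \<and>
    (\<forall>X\<in>Obj C.
      Comp D (fobj L X) (fobj L (fobj R (fobj L X))) (fobj L X)
        (\<epsilon> (fobj L X)) (fmor L X (fobj R (fobj L X)) (\<eta> X)) = Ident D (fobj L X)) \<and>
    (\<forall>Y\<in>Obj D.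
      Comp C (fobj R Y) (fobj R (fobj L (fobj R Y))) (fobj R Y)
        (fmor R (fobj L (fobj R Y)) Y (\<epsilon> Y)) (\<eta> (fobj R Y)) = Ident C (fobj R Y))"

definition is_left_adjoint_of ::
  "('o, 'm) cat \<Rightarrow> ('p, 'n) cat \<Rightarrow> ('o, 'm, 'p, 'n) func \<Rightarrow> ('p, 'n, 'o, 'm) func \<Rightarrow> bool" where
  "is_left_adjoint_of C D L R \<longleftrightarrow> (\<exists>\<eta> \<epsilon>. adjunction C D L R \<eta> \<epsilon>)"

definition has_left_adjoint ::
  "('o, 'm) cat \<Rightarrow> ('p, 'n) cat \<Rightarrow> ('o, 'm, 'p, 'n) func \<Rightarrow> bool" where
  "has_left_adjoint C D F \<longleftrightarrow> (\<exists>L. is_left_adjoint_of D C L F)"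

definition has_right_adjoint ::
  "('o, 'm) cat \<Rightarrow> ('p, 'n) cat \<Rightarrow> ('o, 'm, 'p, 'n) func \<Rightarrow> bool" where
  "has_right_adjoint C D F \<longleftrightarrow> (\<exists>R. is_left_adjoint_of C D F R)"


section \<open>Reflections, coreflections, bireflections, equivalences\<close>

definition reflection ::
  "('o, 'm) cat \<Rightarrow> ('p, 'n) cat \<Rightarrow> ('o, 'm, 'p, 'n) func \<Rightarrow> bool" where
  "reflection C D F \<longleftrightarrow> cat_functor C D F \<and>
    (\<exists>R. fully_faithful D C R \<and> is_left_adjoint_of C D F R)"

definition coreflection ::
  "('o, 'm) cat \<Rightarrow> ('p, 'n) cat \<Rightarrow> ('o, 'm, 'p, 'n) func \<Rightarrow> bool" where
  "coreflection C D F \<longleftrightarrow> cat_functor C D F \<and>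
    (\<exists>L. fully_faithful D C L \<and> is_left_adjoint_of D C L F)"

text \<open>Here \<open>\<eta>l\<close>, \<open>\<epsilon>l\<close> belong to \<open>F \<stileturn> G\<close> and \<open>\<eta>r\<close>, \<open>\<epsilon>r\<close> to \<open>G \<stileturn> F\<close>; the two
  adjunctions are part of the existentially quantified data.\<close>

definition bireflection ::
  "('p, 'n) cat \<Rightarrow> ('o, 'm) cat \<Rightarrow> ('p, 'n, 'o, 'm) func \<Rightarrow> bool" where
  "bireflection D C G \<longleftrightarrow> cat_functor D C G \<and>
    (\<exists>F \<eta>l \<epsilon>l \<eta>r \<epsilon>r. fully_faithful C D F \<and>
      adjunction C D F G \<eta>l \<epsilon>l \<and> adjunction D C G F \<eta>r \<epsilon>r \<and>
      (\<forall>Y\<in>Obj D.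
        Comp D (fobj F (fobj G Y)) Y (fobj F (fobj G Y)) (\<eta>r Y) (\<epsilon>l Y)
          = Ident D (fobj F (fobj G Y))))"

definition equivalence ::
  "('o, 'm) cat \<Rightarrow> ('p, 'n) cat \<Rightarrow> ('o, 'm, 'p, 'n) func \<Rightarrow> bool" where
  "equivalence C D F \<longleftrightarrow> cat_functor C D F \<and>
    (\<exists>G \<alpha> \<beta>. cat_functor D C G \<and>
      nat_iso C C id_func (comp_func G F) \<alpha> \<and> nat_iso D D (comp_func F G) id_func \<beta>)"


section \<open>Idempotent completion\<close>

definition idem_completion :: "('o, 'm) cat \<Rightarrow> ('o \<times> 'm, 'm) cat" where
  "idem_completion C =
    \<lparr>Obj = {(X, e). X \<in> Obj C \<and> e \<in> Hom C X X \<and> Comp C X X X e e = e},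
     Hom = (\<lambda>(X, e) (X', e').
       {f \<in> Hom C X X'. f = Comp C X X' X' e' (Comp C X X X' f e)}),
     Comp = (\<lambda>(X, _) (Y, _) (Z, _) g f. Comp C X Y Z g f),
     Ident = snd\<rparr>"

definition func_completion ::
  "('o, 'm, 'p, 'n) func \<Rightarrow> ('o \<times> 'm, 'm, 'p \<times> 'n, 'n) func" where
  "func_completion F =
    \<lparr>fobj = (\<lambda>(X, e). (fobj F X, fmor F X X e)),
     fmor = (\<lambda>(X, _) (Y, _) f. fmor F X Y f)\<rparr>"

lemma idem_completion_HomD:
  assumes "category C" "X \<in> Obj C" "Y \<in> Obj C"
    and "e \<in> Hom C X X" "Comp C X X X e e = e" "e' \<in> Hom C Y Y" "Comp C Y Y Y e' e' = e'"
    and f: "f \<in> Hom C X Y" "f = Comp C X Y Y e' (Comp C X X Y f e)"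
  shows "Comp C X X Y f e = f" "Comp C X Y Y e' f = f"
proof -
  interpret category C by fact
  note a = assms(2-8)
  have h: "Comp C X X Y f e \<in> Hom C X Y" using a by (intro Comp_in_Hom)
  have "Comp C X X Y f e = Comp C X X Y (Comp C X Y Y e' (Comp C X X Y f e)) e"
    using f(2) by simp
  also have "\<dots> = Comp C X Y Y e' (Comp C X X Y f (Comp C X X X e e))"
    using a h by (metis Comp_assoc)
  finally show "Comp C X X Y f e = f" using f(2) a by simp
  have "Comp C X Y Y e' f = Comp C X Y Y e' (Comp C X Y Y e' (Comp C X X Y f e))"
    using f(2) by simp
  also have "\<dots> = Comp C X Y Y (Comp C Y Y Y e' e') (Comp C X X Y f e)"
    using a h by (metis Comp_assoc)
  finally show "Comp C X Y Y e' f = f" using f(2) a by simp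
qed

lemma idem_completion_Hom_iff:
  assumes "category C" "X \<in> Obj C" "Y \<in> Obj C"
    and "e \<in> Hom C X X" "Comp C X X X e e = e" "e' \<in> Hom C Y Y" "Comp C Y Y Y e' e' = e'"
  shows "f \<in> Hom (idem_completion C) (X, e) (Y, e') \<longleftrightarrow>
    f \<in> Hom C X Y \<and> Comp C X X Y f e = f \<and> Comp C X Y Y e' f = f"
  using idem_completion_HomD[OF assms] by (auto simp: idem_completion_def)

lemma category_idem_completion:
  assumes "category C"
  shows "category (idem_completion C)"
proof -
  interpret category C by fact
  let ?K = "idem_completion C"
  have obj: "(X, e) \<in> Obj ?K \<longleftrightarrow> X \<in> Obj C \<and> e \<in> Hom C X X \<and> Comp C X X X e e = e" for X e
    by (simp add: idem_completion_def)
  have cmp: "Comp ?K (X, e) (Y, e') (Z, e'') g f = Comp C X Y Z g f" for X e Y e' Z e'' g f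
    by (simp add: idem_completion_def)
  have idn: "Ident ?K (X, e) = e" for X e by (simp add: idem_completion_def)
  note hom = idem_completion_Hom_iff[OF assms]
  show ?thesis
  proof (unfold_locales, goal_cases)
    case (1 X) then show ?case by (cases X) (simp add: obj hom idn)
  next
    case (2 X Y Z f g) then show ?case
      by (cases X; cases Y; cases Z) (simp add: obj hom cmp Comp_in_Hom, metis Comp_assoc)
  next
    case (3 X Y f) then show ?case by (cases X; cases Y) (simp add: obj hom cmp idn)
  next
    case (4 X Y f) then show ?case by (cases X; cases Y) (simp add: obj hom cmp idn)
  next
    case (5 W X Y Z f g h) then show ?case
      by (cases W; cases X; cases Y; cases Z) (simp add: obj hom cmp Comp_assoc)
  qed
qed

lemma cat_functor_func_completion:
  assumes "cat_functor C D F"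
  shows "cat_functor (idem_completion C) (idem_completion D) (func_completion F)"
proof -
  interpret cat_functor C D F by fact
  interpret KC: category "idem_completion C"
    by (rule category_idem_completion) (rule source.category_axioms)
  interpret KD: category "idem_completion D"
    by (rule category_idem_completion) (rule target.category_axioms)
  have obj: "(X, e) \<in> Obj (idem_completion C) \<longleftrightarrow>
      X \<in> Obj C \<and> e \<in> Hom C X X \<and> Comp C X X X e e = e"
    for X :: 'a and e :: 'b and C by (simp add: idem_completion_def)
  have obj': "(X, e) \<in> Obj (idem_completion D) \<longleftrightarrow>
      X \<in> Obj D \<and> e \<in> Hom D X X \<and> Comp D X X X e e = e"
    for X e by (simp add: idem_completion_def)
  note homC = idem_completion_Hom_iff[OF source.category_axioms]
  note homD = idem_completion_Hom_iff[OF target.category_axioms]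
  have idem: "Comp D (fobj F X) (fobj F X) (fobj F X) (fmor F X X e) (fmor F X X e) = fmor F X X e"
    if "X \<in> Obj C" "e \<in> Hom C X X" "Comp C X X X e e = e" for X e
    using that by (metis fmor_Comp)
  show ?thesis
  proof (unfold_locales, goal_cases)
    case (1 X) then show ?case
      by (cases X) (simp add: obj obj' func_completion_def fobj_in_Obj fmor_in_Hom idem)
  next
    case (2 X Y f) then show ?case
      by (cases X; cases Y)
        (simp add: obj homC homD func_completion_def fobj_in_Obj fmor_in_Hom idem, metis fmor_Comp)
  next
    case (3 X) then show ?case
      by (cases X) (simp add: func_completion_def idem_completion_def)
  next
    case (4 X Y Z f g) then show ?case
      by (cases X; cases Y; cases Z)
        (simp add: obj homC func_completion_def, simp add: idem_completion_def fmor_Comp)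
  qed
qed

definition reflection_up_to_retracts ::
  "('o, 'm) cat \<Rightarrow> ('p, 'n) cat \<Rightarrow> ('o, 'm, 'p, 'n) func \<Rightarrow> bool" where
  "reflection_up_to_retracts C D F \<longleftrightarrow>
    reflection (idem_completion C) (idem_completion D) (func_completion F)"

definition coreflection_up_to_retracts ::
  "('o, 'm) cat \<Rightarrow> ('p, 'n) cat \<Rightarrow> ('o, 'm, 'p, 'n) func \<Rightarrow> bool" where
  "coreflection_up_to_retracts C D F \<longleftrightarrow>
    coreflection (idem_completion C) (idem_completion D) (func_completion F)"

definition bireflection_up_to_retracts ::
  "('o, 'm) cat \<Rightarrow> ('p, 'n) cat \<Rightarrow> ('o, 'm, 'p, 'n) func \<Rightarrow> bool" where
  "bireflection_up_to_retracts C D F \<longleftrightarrow>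
    bireflection (idem_completion C) (idem_completion D) (func_completion F)"

definition equivalence_up_to_retracts ::
  "('o, 'm) cat \<Rightarrow> ('p, 'n) cat \<Rightarrow> ('o, 'm, 'p, 'n) func \<Rightarrow> bool" where
  "equivalence_up_to_retracts C D F \<longleftrightarrow>
    equivalence (idem_completion C) (idem_completion D) (func_completion F)"

end

theory Submission
  imports Defs
begin

text \<open>
  Each notion is replaced by a condition on \<open>F\<close> that does not mention an adjoint and therefore
  passes from \<open>F\<^sup>\<natural>\<close> to \<open>F\<close> along the fully faithful embedding of \<open>C\<close>. A reflection has the
  property that every \<open>Y\<close> is a retract of some \<open>F Z\<close>, with section \<open>s : Y \<rightarrow> F Z\<close>, such that \<open>s \<circ> h\<close> is in
  the image of \<open>F\<close> for all \<open>h : F X \<rightarrow> Y\<close>; a coreflection has the dual property. If \<open>F\<close> has a right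
  adjoint, either property forces the counit to be invertible, i.e. the adjoint to be fully
  faithful. A bireflection is moreover full, and faithful modulo the natural idempotent
  \<open>i = \<epsilon>l \<circ> \<eta>r\<close>; conversely, for a reflection \<open>F\<close> with fully faithful right adjoint \<open>R\<close> the lifts
  \<open>j : R F X \<rightarrow> X\<close> of the counit along \<open>F\<close> with \<open>i \<circ> j = j\<close> form the counit of \<open>R \<stileturn> F\<close>.
  Left adjoints are treated by passing to opposite categories.
\<close>

section \<open>Simplification rules for categories, functors and their composites\<close>

context category
begin

declare Ident_in_Hom [simp] Comp_in_Hom [simp] Comp_Ident_right [simp] Comp_Ident_left [simp]

end

context cat_functor
begin

declare fobj_in_Obj [simp] fmor_in_Hom [simp] fmor_Ident [simp]

end

lemma id_func_simps [simp]: "fobj id_func X = X" "fmor id_func X Y f = f"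
  by (simp_all add: id_func_def)

lemma comp_func_simps [simp]:
  "fobj (comp_func G F) X = fobj G (fobj F X)"
  "fmor (comp_func G F) X Y f = fmor G (fobj F X) (fobj F Y) (fmor F X Y f)"
  by (simp_all add: comp_func_def)

lemma cat_functor_id_func: "category C \<Longrightarrow> cat_functor C C id_func"
  by (simp add: cat_functor_def cat_functor_axioms_def)

lemma cat_functor_comp_func:
  assumes "cat_functor C D F" "cat_functor D E G"
  shows "cat_functor C E (comp_func G F)"
proof -
  interpret F: cat_functor C D F by fact
  interpret G: cat_functor D E G by fact
  show ?thesis by unfold_locales (simp_all add: F.fmor_Comp G.fmor_Comp)
qed

section \<open>Duality\<close>

definition op_cat :: "('o, 'm) cat \<Rightarrow> ('o, 'm) cat" where
  "op_cat C = \<lparr>Obj = Obj C, Hom = (\<lambda>X Y. Hom C Y X), Comp = (\<lambda>X Y Z g f. Comp C Z Y X f g),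
    Ident = Ident C\<rparr>"

definition op_func :: "('o, 'm, 'p, 'n) func \<Rightarrow> ('o, 'm, 'p, 'n) func" where
  "op_func F = \<lparr>fobj = fobj F, fmor = (\<lambda>X Y. fmor F Y X)\<rparr>"

lemma op_cat_simps [simp]:
  "Obj (op_cat C) = Obj C" "Hom (op_cat C) X Y = Hom C Y X"
  "Comp (op_cat C) X Y Z g f = Comp C Z Y X f g" "Ident (op_cat C) = Ident C"
  by (simp_all add: op_cat_def)

lemma op_func_simps [simp]: "fobj (op_func F) = fobj F" "fmor (op_func F) X Y = fmor F Y X"
  by (simp_all add: op_func_def)

text \<open>Dualizing twice gives back the same record, so a result obtained for opposite categories
  simplifies straight back to the original ones.\<close>

lemma op_op_cat [simp]: "op_cat (op_cat C) = C"
  by (simp add: op_cat_def)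

lemma op_op_func [simp]: "op_func (op_func F) = F"
  by (simp add: op_func_def)

lemma op_id_func: "op_func id_func = id_func"
  by (simp add: op_func_def id_func_def)

lemma op_comp_func: "op_func (comp_func G F) = comp_func (op_func G) (op_func F)"
  by (simp add: op_func_def comp_func_def)

lemma category_op: "category C \<Longrightarrow> category (op_cat C)"
  by (simp add: category_def)

lemma cat_functor_op:
  assumes "cat_functor C D F"
  shows "cat_functor (op_cat C) (op_cat D) (op_func F)"
proof -
  interpret cat_functor C D F by fact
  show ?thesis
    by (intro cat_functor.intro category_op source.category_axioms target.category_axioms)
      (simp add: cat_functor_axioms_def fmor_Comp)
qed

lemma fully_faithful_op:
  "fully_faithful C D F \<Longrightarrow> fully_faithful (op_cat C) (op_cat D) (op_func F)"
  by (simp add: fully_faithful_def cat_functor_op)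

lemma nat_trans_op:
  "nat_trans C D F G \<tau> \<Longrightarrow> nat_trans (op_cat C) (op_cat D) (op_func G) (op_func F) \<tau>"
  by (simp add: nat_trans_def cat_functor_op)

lemma is_iso_op [simp]: "is_iso (op_cat C) X Y f = is_iso C Y X f"
  by (auto simp: is_iso_def)

text \<open>Reversing morphisms turns the counit into a unit and the unit into a counit, and it
  exchanges the two triangle identities.\<close>

lemma adjunction_op:
  assumes "adjunction C D L R \<eta> \<epsilon>"
  shows "adjunction (op_cat D) (op_cat C) (op_func R) (op_func L) \<epsilon> \<eta>"
  using assms nat_trans_op[of C C id_func "comp_func R L" \<eta>]
    nat_trans_op[of D D "comp_func L R" id_func \<epsilon>]
  by (simp add: adjunction_def cat_functor_op op_id_func op_comp_func)

lemma has_right_adjoint_op: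
  assumes "has_left_adjoint C D F"
  shows "has_right_adjoint (op_cat C) (op_cat D) (op_func F)"
proof -
  obtain G \<eta> \<epsilon> where "adjunction D C G F \<eta> \<epsilon>"
    using assms unfolding has_left_adjoint_def is_left_adjoint_of_def by blast
  from adjunction_op[OF this] show ?thesis
    unfolding has_right_adjoint_def is_left_adjoint_of_def by blast
qed

lemma reflection_op:
  assumes "coreflection C D F"
  shows "reflection (op_cat C) (op_cat D) (op_func F)"
proof -
  obtain G \<eta> \<epsilon> where "cat_functor C D F" "fully_faithful D C G" "adjunction D C G F \<eta> \<epsilon>"
    using assms unfolding coreflection_def is_left_adjoint_of_def by blast
  from cat_functor_op[OF this(1)] fully_faithful_op[OF this(2)] adjunction_op[OF this(3)]
  show ?thesis unfolding reflection_def is_left_adjoint_of_def by blast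
qed

lemma coreflection_op:
  assumes "reflection C D F"
  shows "coreflection (op_cat C) (op_cat D) (op_func F)"
proof -
  obtain G \<eta> \<epsilon> where "cat_functor C D F" "fully_faithful D C G" "adjunction C D F G \<eta> \<epsilon>"
    using assms unfolding reflection_def is_left_adjoint_of_def by blast
  from cat_functor_op[OF this(1)] fully_faithful_op[OF this(2)] adjunction_op[OF this(3)]
  show ?thesis unfolding coreflection_def is_left_adjoint_of_def by blast
qed

text \<open>The notion is self-dual: the two adjunctions change places, \<open>\<eta>r\<close>
  becomes the counit and \<open>\<epsilon>l\<close> the unit that enter the splitting condition, and
  the reversed composite is again \<open>\<eta>r\<close> after \<open>\<epsilon>l\<close>.\<close>

lemma bireflection_op:
  assumes "bireflection C D F"
  shows "bireflection (op_cat C) (op_cat D) (op_func F)"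
proof -
  obtain G \<eta>l \<epsilon>l \<eta>r \<epsilon>r where
    "cat_functor C D F" "fully_faithful D C G"
    "adjunction D C G F \<eta>l \<epsilon>l" "adjunction C D F G \<eta>r \<epsilon>r"
    "\<forall>Y\<in>Obj C. Comp C (fobj G (fobj F Y)) Y (fobj G (fobj F Y)) (\<eta>r Y) (\<epsilon>l Y)
      = Ident C (fobj G (fobj F Y))"
    using assms unfolding bireflection_def by blast
  then show ?thesis
    unfolding bireflection_def
    by (intro conjI exI[of _ "op_func G"] exI[of _ \<epsilon>r] exI[of _ \<eta>r] exI[of _ \<epsilon>l] exI[of _ \<eta>l])
      (simp_all add: cat_functor_op fully_faithful_op adjunction_op)
qed

section \<open>Isomorphisms and adjunctions\<close>

lemma nat_iso_inverse:
  assumes "nat_iso C D F G \<tau>"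
  obtains \<sigma> where "nat_iso C D G F \<sigma>"
    and "\<And>X. X \<in> Obj C \<Longrightarrow>
      Comp D (fobj F X) (fobj G X) (fobj F X) (\<sigma> X) (\<tau> X) = Ident D (fobj F X)"
    and "\<And>X. X \<in> Obj C \<Longrightarrow>
      Comp D (fobj G X) (fobj F X) (fobj G X) (\<tau> X) (\<sigma> X) = Ident D (fobj G X)"
proof -
  interpret F: cat_functor C D F using assms by (simp add: nat_iso_def nat_trans_def)
  interpret G: cat_functor C D G using assms by (simp add: nat_iso_def nat_trans_def)
  have \<tau>: "\<tau> X \<in> Hom D (fobj F X) (fobj G X)" if "X \<in> Obj C" for X
    using assms that by (simp add: nat_iso_def nat_trans_def)
  have nat: "Comp D (fobj F X) (fobj F Y) (fobj G Y) (\<tau> Y) (fmor F X Y f) =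
      Comp D (fobj F X) (fobj G X) (fobj G Y) (fmor G X Y f) (\<tau> X)"
    if "X \<in> Obj C" "Y \<in> Obj C" "f \<in> Hom C X Y" for X Y f
    using assms that by (simp add: nat_iso_def nat_trans_def)
  obtain \<sigma> where \<sigma>: "\<And>X. X \<in> Obj C \<Longrightarrow> \<sigma> X \<in> Hom D (fobj G X) (fobj F X)"
    and \<sigma>\<tau>: "\<And>X. X \<in> Obj C \<Longrightarrow>
      Comp D (fobj F X) (fobj G X) (fobj F X) (\<sigma> X) (\<tau> X) = Ident D (fobj F X)"
    and \<tau>\<sigma>: "\<And>X. X \<in> Obj C \<Longrightarrow>
      Comp D (fobj G X) (fobj F X) (fobj G X) (\<tau> X) (\<sigma> X) = Ident D (fobj G X)"
    using assms unfolding nat_iso_def is_iso_def by metis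
  \<comment> \<open>Naturality of the inverse: insert \<open>\<tau> X\<close> after
    \<open>\<sigma> X\<close> on the right, move \<open>\<tau>\<close> past \<open>f\<close>, then
    cancel it against \<open>\<sigma> Y\<close> on the left.\<close>
  have "Comp D (fobj G X) (fobj G Y) (fobj F Y) (\<sigma> Y) (fmor G X Y f) =
      Comp D (fobj G X) (fobj F X) (fobj F Y) (fmor F X Y f) (\<sigma> X)"
    if X: "X \<in> Obj C" and Y: "Y \<in> Obj C" and f: "f \<in> Hom C X Y" for X Y f
  proof -
    let ?c = "Comp D (fobj G X) (fobj G Y) (fobj F Y) (\<sigma> Y)"
    have "?c (fmor G X Y f) =
        ?c (Comp D (fobj G X) (fobj G X) (fobj G Y) (fmor G X Y f)
          (Comp D (fobj G X) (fobj F X) (fobj G X) (\<tau> X) (\<sigma> X)))"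
      using X Y f by (simp add: \<tau>\<sigma>)
    also have "\<dots> = ?c (Comp D (fobj G X) (fobj F X) (fobj G Y)
        (Comp D (fobj F X) (fobj F Y) (fobj G Y) (\<tau> Y) (fmor F X Y f)) (\<sigma> X))"
      using X Y f \<tau> \<sigma> by (simp add: nat F.target.Comp_assoc)
    also have "\<dots> = ?c (Comp D (fobj G X) (fobj F Y) (fobj G Y) (\<tau> Y)
        (Comp D (fobj G X) (fobj F X) (fobj F Y) (fmor F X Y f) (\<sigma> X)))"
      using X Y f \<tau> \<sigma> by (simp add: F.target.Comp_assoc)
    also have "\<dots> = Comp D (fobj G X) (fobj F X) (fobj F Y) (fmor F X Y f) (\<sigma> X)"
      using X Y f \<tau> \<sigma> by (subst F.target.Comp_assoc) (simp_all add: \<sigma>\<tau>)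
    finally show ?thesis .
  qed
  then have "nat_iso C D G F \<sigma>"
    unfolding nat_iso_def nat_trans_def is_iso_def
    using F.cat_functor_axioms G.cat_functor_axioms \<sigma> \<tau> \<sigma>\<tau> \<tau>\<sigma> by blast
  then show thesis using \<sigma>\<tau> \<tau>\<sigma> that by blast
qed

section \<open>The hom-set bijection of an adjunction and invertibility of its counit\<close>

locale adjoint_functors = left: cat_functor C D L + right: cat_functor D C R
  for C :: "('o, 'm) cat" and D :: "('p, 'n) cat"
    and L :: "('o, 'm, 'p, 'n) func" and R :: "('p, 'n, 'o, 'm) func" +
  fixes \<eta> :: "'o \<Rightarrow> 'm" and \<epsilon> :: "'p \<Rightarrow> 'n"
  assumes adjunction: "adjunction C D L R \<eta> \<epsilon>"
begin

lemma unit_in_Hom [simp]: "X \<in> Obj C \<Longrightarrow> \<eta> X \<in> Hom C X (fobj R (fobj L X))"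
  and counit_in_Hom [simp]: "Y \<in> Obj D \<Longrightarrow> \<epsilon> Y \<in> Hom D (fobj L (fobj R Y)) Y"
  using adjunction by (simp_all add: adjunction_def nat_trans_def)

lemma unit_natural:
  "\<lbrakk>X \<in> Obj C; Y \<in> Obj C; f \<in> Hom C X Y\<rbrakk> \<Longrightarrow>
    Comp C X Y (fobj R (fobj L Y)) (\<eta> Y) f =
    Comp C X (fobj R (fobj L X)) (fobj R (fobj L Y))
      (fmor R (fobj L X) (fobj L Y) (fmor L X Y f)) (\<eta> X)"
  and counit_natural:
  "\<lbrakk>X' \<in> Obj D; Y' \<in> Obj D; g \<in> Hom D X' Y'\<rbrakk> \<Longrightarrow>
    Comp D (fobj L (fobj R X')) (fobj L (fobj R Y')) Y' (\<epsilon> Y')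
      (fmor L (fobj R X') (fobj R Y') (fmor R X' Y' g)) =
    Comp D (fobj L (fobj R X')) X' Y' g (\<epsilon> X')"
  using adjunction by (simp_all add: adjunction_def nat_trans_def)

lemma triangle_left [simp]:
  "X \<in> Obj C \<Longrightarrow> Comp D (fobj L X) (fobj L (fobj R (fobj L X))) (fobj L X)
    (\<epsilon> (fobj L X)) (fmor L X (fobj R (fobj L X)) (\<eta> X)) = Ident D (fobj L X)"
  and triangle_right [simp]:
  "Y \<in> Obj D \<Longrightarrow> Comp C (fobj R Y) (fobj R (fobj L (fobj R Y))) (fobj R Y)
    (fmor R (fobj L (fobj R Y)) Y (\<epsilon> Y)) (\<eta> (fobj R Y)) = Ident C (fobj R Y)"
  using adjunction by (simp_all add: adjunction_def)

text \<open>Surjectivity of the transposition from \<open>Hom C X (fobj R Y)\<close> to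
  \<open>Hom D (fobj L X) Y\<close>; the preimage of \<open>g\<close> is \<open>R g\<close> after
  the unit.\<close>

lemma counit_lift:
  assumes "X \<in> Obj C" "Y \<in> Obj D" "g \<in> Hom D (fobj L X) Y"
  obtains f where "f \<in> Hom C X (fobj R Y)"
    and "Comp D (fobj L X) (fobj L (fobj R Y)) Y (\<epsilon> Y) (fmor L X (fobj R Y) f) = g"
proof
  let ?f = "Comp C X (fobj R (fobj L X)) (fobj R Y) (fmor R (fobj L X) Y g) (\<eta> X)"
  show "?f \<in> Hom C X (fobj R Y)" using assms by simp
  have "Comp D (fobj L X) (fobj L (fobj R Y)) Y (\<epsilon> Y) (fmor L X (fobj R Y) ?f) =
      Comp D (fobj L X) (fobj L (fobj R (fobj L X))) Y
        (Comp D (fobj L (fobj R (fobj L X))) (fobj L (fobj R Y)) Y (\<epsilon> Y)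
          (fmor L (fobj R (fobj L X)) (fobj R Y) (fmor R (fobj L X) Y g)))
        (fmor L X (fobj R (fobj L X)) (\<eta> X))"
    using assms by (simp add: left.fmor_Comp left.target.Comp_assoc)
  also have "\<dots> = g"
    using assms
    by (simp add: counit_natural left.target.Comp_assoc[symmetric])
  finally show "Comp D (fobj L X) (fobj L (fobj R Y)) Y (\<epsilon> Y) (fmor L X (fobj R Y) ?f) = g" .
qed

text \<open>Injectivity of the same transposition: transposing back with the unit recovers
  \<open>k\<close>. This is the main device below for proving equality of morphisms into some
  \<open>fobj R Y\<close>.\<close>

lemma counit_cancel:
  assumes "X \<in> Obj C" "Y \<in> Obj D" "f \<in> Hom C X (fobj R Y)" "f' \<in> Hom C X (fobj R Y)"
    and eq: "Comp D (fobj L X) (fobj L (fobj R Y)) Y (\<epsilon> Y) (fmor L X (fobj R Y) f) =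
      Comp D (fobj L X) (fobj L (fobj R Y)) Y (\<epsilon> Y) (fmor L X (fobj R Y) f')"
  shows "f = f'"
proof -
  have "Comp C X (fobj R (fobj L X)) (fobj R Y) (fmor R (fobj L X) Y
      (Comp D (fobj L X) (fobj L (fobj R Y)) Y (\<epsilon> Y) (fmor L X (fobj R Y) k))) (\<eta> X) = k"
    (is "?t k = k") if k: "k \<in> Hom C X (fobj R Y)" for k
  proof -
    have "?t k = Comp C X (fobj R (fobj L (fobj R Y))) (fobj R Y)
        (fmor R (fobj L (fobj R Y)) Y (\<epsilon> Y))
        (Comp C X (fobj R (fobj L X)) (fobj R (fobj L (fobj R Y)))
          (fmor R (fobj L X) (fobj L (fobj R Y)) (fmor L X (fobj R Y) k)) (\<eta> X))"
      using assms(1,2) k by (simp add: right.fmor_Comp left.source.Comp_assoc)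
    also have "\<dots> = k"
      using assms(1,2) k
      by (simp add: unit_natural[symmetric] left.source.Comp_assoc)
    finally show ?thesis .
  qed
  from this[OF assms(3)] this[OF assms(4)] eq show ?thesis by metis
qed

end

lemma adjoint_functors_of_adjunction:
  assumes "adjunction C D L R \<eta> \<epsilon>"
  shows "adjoint_functors C D L R \<eta> \<epsilon>"
  using assms by (simp add: adjoint_functors_def adjoint_functors_axioms_def adjunction_def)

lemma adjoint_functors_op:
  assumes "adjoint_functors C D L R \<eta> \<epsilon>"
  shows "adjoint_functors (op_cat D) (op_cat C) (op_func R) (op_func L) \<epsilon> \<eta>"
  by (intro adjoint_functors_of_adjunction adjunction_op adjoint_functors.adjunction[OF assms])

context adjoint_functors
begin

text \<open>This is \<open>counit_cancel\<close> for the opposite adjunction, whose counit is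
  \<open>\<eta>\<close>.\<close>

lemma unit_cancel:
  assumes "X \<in> Obj C" "Y \<in> Obj D" "g \<in> Hom D (fobj L X) Y" "g' \<in> Hom D (fobj L X) Y"
    and "Comp C X (fobj R (fobj L X)) (fobj R Y) (fmor R (fobj L X) Y g) (\<eta> X) =
      Comp C X (fobj R (fobj L X)) (fobj R Y) (fmor R (fobj L X) Y g') (\<eta> X)"
  shows "g = g'"
  using adjoint_functors.counit_cancel[OF adjoint_functors_op[OF adjoint_functors_axioms], of Y X g g']
    assms by simp

text \<open>The inverse \<open>s\<close> is the morphism that \<open>R\<close> sends to the unit at
  \<open>fobj R Y\<close>. Faithfulness turns the right triangle identity into
  \<open>\<epsilon> Y\<close> after \<open>s\<close> being the identity; naturality of
  \<open>\<epsilon>\<close> at \<open>s\<close> together with the left triangle identity gives the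
  other composite.\<close>

lemma counit_iso:
  assumes ff: "fully_faithful D C R" and Y: "Y \<in> Obj D"
  shows "is_iso D (fobj L (fobj R Y)) Y (\<epsilon> Y)"
proof -
  let ?LR = "fobj L (fobj R Y)"
  have bij: "bij_betw (fmor R Y' Y'') (Hom D Y' Y'') (Hom C (fobj R Y') (fobj R Y''))"
    if "Y' \<in> Obj D" "Y'' \<in> Obj D" for Y' Y''
    using ff that by (simp add: fully_faithful_def)
  have "\<eta> (fobj R Y) \<in> fmor R Y ?LR ` Hom D Y ?LR"
    using bij[of Y ?LR] Y by (simp add: bij_betw_def)
  then obtain s where s: "s \<in> Hom D Y ?LR" and Rs: "fmor R Y ?LR s = \<eta> (fobj R Y)" by auto
  have "fmor R Y Y (Comp D Y ?LR Y (\<epsilon> Y) s) = fmor R Y Y (Ident D Y)"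
    using Y s by (simp add: right.fmor_Comp Rs)
  then have 1: "Comp D Y ?LR Y (\<epsilon> Y) s = Ident D Y"
    using inj_onD[OF bij_betw_imp_inj_on[OF bij[of Y Y]]] Y s by simp
  have "Comp D ?LR Y ?LR s (\<epsilon> Y) = Ident D ?LR"
    using counit_natural[of Y ?LR s] Y s by (simp add: Rs)
  with 1 s Y show ?thesis by (auto simp: is_iso_def)
qed

text \<open>By naturality of \<open>\<epsilon>\<close>, the morphism \<open>R g\<close> is the
  transpose of \<open>g\<close> after \<open>\<epsilon> Y\<close>. Hence \<open>R\<close> acts on a
  hom-set as precomposition with an isomorphism followed by the transposition bijection.\<close>

lemma right_fully_faithful:
  assumes iso: "\<And>Y. Y \<in> Obj D \<Longrightarrow> is_iso D (fobj L (fobj R Y)) Y (\<epsilon> Y)"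
  shows "fully_faithful D C R"
  unfolding fully_faithful_def
proof (intro conjI ballI right.cat_functor_axioms)
  fix Y Y' assume Y: "Y \<in> Obj D" and Y': "Y' \<in> Obj D"
  let ?LR = "fobj L (fobj R Y)"
  obtain s where s: "s \<in> Hom D Y ?LR" and sl: "Comp D ?LR Y ?LR s (\<epsilon> Y) = Ident D ?LR"
    and sr: "Comp D Y ?LR Y (\<epsilon> Y) s = Ident D Y"
    using iso[OF Y] by (auto simp: is_iso_def)
  show "bij_betw (fmor R Y Y') (Hom D Y Y') (Hom C (fobj R Y) (fobj R Y'))"
    unfolding bij_betw_def
  proof
    show "inj_on (fmor R Y Y') (Hom D Y Y')"
    proof (rule inj_onI)
      fix g g' assume g: "g \<in> Hom D Y Y'" "g' \<in> Hom D Y Y'" and eq: "fmor R Y Y' g = fmor R Y Y' g'"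
      have "Comp D ?LR Y Y' g (\<epsilon> Y) = Comp D ?LR Y Y' g' (\<epsilon> Y)"
        using counit_natural[of Y Y' g] counit_natural[of Y Y' g'] Y Y' g eq by simp
      then have "Comp D Y ?LR Y' (Comp D ?LR Y Y' g (\<epsilon> Y)) s =
          Comp D Y ?LR Y' (Comp D ?LR Y Y' g' (\<epsilon> Y)) s" by simp
      then show "g = g'"
        using Y Y' g s by (simp add: left.target.Comp_assoc[symmetric] sr)
    qed
    have "f \<in> fmor R Y Y' ` Hom D Y Y'" if f: "f \<in> Hom C (fobj R Y) (fobj R Y')" for f
    proof
      \<comment> \<open>\<open>t\<close> is the transpose of \<open>f\<close>; dividing it by the
        invertible \<open>\<epsilon> Y\<close> gives the preimage \<open>g\<close>.\<close>
      define t where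
        "t = Comp D ?LR (fobj L (fobj R Y')) Y' (\<epsilon> Y') (fmor L (fobj R Y) (fobj R Y') f)"
      have t: "t \<in> Hom D ?LR Y'" using Y Y' f by (simp add: t_def)
      define g where "g = Comp D Y ?LR Y' t s"
      show g: "g \<in> Hom D Y Y'" using Y Y' t s by (simp add: g_def)
      have "Comp D ?LR Y Y' g (\<epsilon> Y) = t"
        using Y Y' t s by (simp add: g_def left.target.Comp_assoc[symmetric] sl)
      then show "f = fmor R Y Y' g"
        using counit_natural[of Y Y' g] Y Y' f g
        by - (rule counit_cancel[of "fobj R Y" Y'], simp_all add: t_def)
    qed
    moreover have "fmor R Y Y' ` Hom D Y Y' \<subseteq> Hom C (fobj R Y) (fobj R Y')"
      using Y Y' by auto
    ultimately show "fmor R Y Y' ` Hom D Y Y' = Hom C (fobj R Y) (fobj R Y')"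
      by blast
  qed
qed

lemma reflection_of_counit_iso:
  assumes "\<And>Y. Y \<in> Obj D \<Longrightarrow> is_iso D (fobj L (fobj R Y)) Y (\<epsilon> Y)"
  shows "reflection C D L"
  using right_fully_faithful[OF assms] adjunction left.cat_functor_axioms
  unfolding reflection_def is_left_adjoint_of_def by blast

end

section \<open>Functors full up to retracts\<close>

text \<open>The splitting \<open>q \<circ> s = Id\<close> is not required to be an isomorphism: for a reflection it is the
  counit with its inverse, but restricting from the idempotent completion leaves only a retract.\<close>

definition retract_full ::
  "('o, 'm) cat \<Rightarrow> ('p, 'n) cat \<Rightarrow> ('o, 'm, 'p, 'n) func \<Rightarrow> bool" where
  "retract_full C D F \<longleftrightarrow> (\<forall>Y\<in>Obj D. \<exists>Z\<in>Obj C. \<exists>q\<in>Hom D (fobj F Z) Y. \<exists>s\<in>Hom D Y (fobj F Z).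
    Comp D Y (fobj F Z) Y q s = Ident D Y \<and>
    (\<forall>X\<in>Obj C. \<forall>h\<in>Hom D (fobj F X) Y. \<exists>k\<in>Hom C X Z.
      fmor F X Z k = Comp D (fobj F X) Y (fobj F Z) s h))"

definition retract_cofull ::
  "('o, 'm) cat \<Rightarrow> ('p, 'n) cat \<Rightarrow> ('o, 'm, 'p, 'n) func \<Rightarrow> bool" where
  "retract_cofull C D F \<longleftrightarrow> (\<forall>Y\<in>Obj D. \<exists>Z\<in>Obj C. \<exists>q\<in>Hom D (fobj F Z) Y. \<exists>s\<in>Hom D Y (fobj F Z).
    Comp D Y (fobj F Z) Y q s = Ident D Y \<and>
    (\<forall>X\<in>Obj C. \<forall>h\<in>Hom D Y (fobj F X). \<exists>k\<in>Hom C Z X.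
      fmor F Z X k = Comp D (fobj F Z) Y (fobj F X) h q))"

lemma retract_full_op: "retract_full (op_cat C) (op_cat D) (op_func F) = retract_cofull C D F"
  unfolding retract_full_def retract_cofull_def by (simp, blast)

lemma retract_cofull_op: "retract_cofull (op_cat C) (op_cat D) (op_func F) = retract_full C D F"
  using retract_full_op[of "op_cat C" "op_cat D" "op_func F"] by simp

text \<open>Take \<open>Z = fobj R Y\<close>, the counit as \<open>q\<close> and its inverse as
  \<open>s\<close>. If \<open>k\<close> is the transpose of \<open>h\<close>, then \<open>h\<close>
  is \<open>\<epsilon> Y\<close> after \<open>F k\<close>, so \<open>s\<close> cancels the counit
  and leaves \<open>F k\<close>.\<close>

lemma retract_full_of_reflection:
  assumes "reflection C D F"
  shows "retract_full C D F"
proof -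
  obtain R \<eta> \<epsilon> where ff: "fully_faithful D C R" and adj: "adjunction C D F R \<eta> \<epsilon>"
    using assms by (auto simp: reflection_def is_left_adjoint_of_def)
  interpret adjoint_functors C D F R \<eta> \<epsilon>
    using adj by (rule adjoint_functors_of_adjunction)
  show ?thesis
    unfolding retract_full_def
  proof
    fix Y assume Y: "Y \<in> Obj D"
    let ?FR = "fobj F (fobj R Y)"
    obtain s where s: "s \<in> Hom D Y ?FR" and sl: "Comp D ?FR Y ?FR s (\<epsilon> Y) = Ident D ?FR"
      and sr: "Comp D Y ?FR Y (\<epsilon> Y) s = Ident D Y"
      using counit_iso[OF ff Y] by (auto simp: is_iso_def)
    have "\<exists>k\<in>Hom C X (fobj R Y). fmor F X (fobj R Y) k = Comp D (fobj F X) Y ?FR s h"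
      if X: "X \<in> Obj C" and h: "h \<in> Hom D (fobj F X) Y" for X h
    proof -
      obtain k where k: "k \<in> Hom C X (fobj R Y)"
        and "Comp D (fobj F X) ?FR Y (\<epsilon> Y) (fmor F X (fobj R Y) k) = h"
        using counit_lift[OF X Y h] .
      then have "Comp D (fobj F X) Y ?FR s h =
          Comp D (fobj F X) Y ?FR s (Comp D (fobj F X) ?FR Y (\<epsilon> Y) (fmor F X (fobj R Y) k))"
        by simp
      also have "\<dots> = fmor F X (fobj R Y) k"
        using X Y s k by (simp add: left.target.Comp_assoc sl)
      finally show ?thesis using k by auto
    qed
    then show "\<exists>Z\<in>Obj C. \<exists>q\<in>Hom D (fobj F Z) Y. \<exists>s\<in>Hom D Y (fobj F Z).
        Comp D Y (fobj F Z) Y q s = Ident D Y \<and>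
        (\<forall>X\<in>Obj C. \<forall>h\<in>Hom D (fobj F X) Y. \<exists>k\<in>Hom C X Z.
          fmor F X Z k = Comp D (fobj F X) Y (fobj F Z) s h)"
      using Y s sr by (intro bexI[of _ "fobj R Y"] bexI[of _ "\<epsilon> Y"] bexI[of _ s]) simp_all
  qed
qed

lemma retract_cofull_of_coreflection: "coreflection C D F \<Longrightarrow> retract_cofull C D F"
  using retract_full_of_reflection[OF reflection_op] by (simp add: retract_full_op)

text \<open>Let \<open>h\<close> be the transpose of \<open>q\<close>, and let \<open>k\<close> lift
  \<open>s\<close> after \<open>\<epsilon> Y\<close> along \<open>L\<close>. The composite
  \<open>h\<close> after \<open>k\<close> has the same transpose as the identity, so it is the
  identity, and \<open>L h\<close> after \<open>s\<close> inverts the counit.\<close>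

lemma (in adjoint_functors) counit_iso_of_retract_full:
  assumes "retract_full C D L" and Y: "Y \<in> Obj D"
  shows "is_iso D (fobj L (fobj R Y)) Y (\<epsilon> Y)"
proof -
  let ?LR = "fobj L (fobj R Y)"
  obtain Z q s where Z: "Z \<in> Obj C" and q: "q \<in> Hom D (fobj L Z) Y" and s: "s \<in> Hom D Y (fobj L Z)"
    and qs: "Comp D Y (fobj L Z) Y q s = Ident D Y"
    and full: "\<And>X h. X \<in> Obj C \<Longrightarrow> h \<in> Hom D (fobj L X) Y \<Longrightarrow>
      \<exists>k\<in>Hom C X Z. fmor L X Z k = Comp D (fobj L X) Y (fobj L Z) s h"
    using assms unfolding retract_full_def by meson
  obtain h where h: "h \<in> Hom C Z (fobj R Y)"
    and \<epsilon>h: "Comp D (fobj L Z) ?LR Y (\<epsilon> Y) (fmor L Z (fobj R Y) h) = q"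
    using counit_lift[OF Z Y q] .
  obtain k where k: "k \<in> Hom C (fobj R Y) Z"
    and Lk: "fmor L (fobj R Y) Z k = Comp D ?LR Y (fobj L Z) s (\<epsilon> Y)"
    using full[of "fobj R Y" "\<epsilon> Y"] Y by auto
  let ?u = "Comp D Y (fobj L Z) ?LR (fmor L Z (fobj R Y) h) s"
  have "Comp D ?LR ?LR Y (\<epsilon> Y) (fmor L (fobj R Y) (fobj R Y) (Comp C (fobj R Y) Z (fobj R Y) h k))
      = Comp D ?LR Y Y (Comp D Y (fobj L Z) Y q s) (\<epsilon> Y)"
    using Y Z h k s by (simp add: left.fmor_Comp Lk left.target.Comp_assoc \<epsilon>h)
  then have hk: "Comp C (fobj R Y) Z (fobj R Y) h k = Ident C (fobj R Y)"
    using Y Z h k by - (rule counit_cancel[of "fobj R Y" Y], simp_all add: qs)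
  have "Comp D ?LR Y ?LR ?u (\<epsilon> Y) =
      fmor L (fobj R Y) (fobj R Y) (Comp C (fobj R Y) Z (fobj R Y) h k)"
    using Y Z h k s by (simp add: left.fmor_Comp Lk left.target.Comp_assoc)
  then have "Comp D ?LR Y ?LR ?u (\<epsilon> Y) = Ident D ?LR"
    using Y by (simp add: hk)
  moreover have "Comp D Y ?LR Y (\<epsilon> Y) ?u = Ident D Y"
    using Y Z h s by (simp add: left.target.Comp_assoc \<epsilon>h qs)
  moreover have "?u \<in> Hom D Y ?LR" using Y Z h s by simp
  ultimately show ?thesis using Y unfolding is_iso_def by auto
qed

text \<open>After precomposition with \<open>q\<close>, both \<open>a\<close> and \<open>b\<close>
  are images under \<open>L\<close> of morphisms into \<open>fobj R Y\<close>, where the counit can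
  be cancelled; \<open>q\<close> is then removed by its section \<open>s\<close>.\<close>

lemma (in adjoint_functors) counit_mono_of_retract_cofull:
  assumes "retract_cofull C D L" and Y: "Y \<in> Obj D" and Y': "Y' \<in> Obj D"
    and a: "a \<in> Hom D Y' (fobj L (fobj R Y))" and b: "b \<in> Hom D Y' (fobj L (fobj R Y))"
    and eq: "Comp D Y' (fobj L (fobj R Y)) Y (\<epsilon> Y) a = Comp D Y' (fobj L (fobj R Y)) Y (\<epsilon> Y) b"
  shows "a = b"
proof -
  let ?LR = "fobj L (fobj R Y)"
  obtain Z q s where Z: "Z \<in> Obj C" and q: "q \<in> Hom D (fobj L Z) Y'"
    and s: "s \<in> Hom D Y' (fobj L Z)"
    and qs: "Comp D Y' (fobj L Z) Y' q s = Ident D Y'"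
    and full: "\<And>X h. X \<in> Obj C \<Longrightarrow> h \<in> Hom D Y' (fobj L X) \<Longrightarrow>
      \<exists>k\<in>Hom C Z X. fmor L Z X k = Comp D (fobj L Z) Y' (fobj L X) h q"
    using assms unfolding retract_cofull_def by meson
  obtain a' where a': "a' \<in> Hom C Z (fobj R Y)"
    and La': "fmor L Z (fobj R Y) a' = Comp D (fobj L Z) Y' ?LR a q"
    using full[of "fobj R Y" a] Y a by auto
  obtain b' where b': "b' \<in> Hom C Z (fobj R Y)"
    and Lb': "fmor L Z (fobj R Y) b' = Comp D (fobj L Z) Y' ?LR b q"
    using full[of "fobj R Y" b] Y b by auto
  have "a' = b'"
    using Y Y' Z a b q a' b'
    by - (rule counit_cancel[of Z Y], simp_all add: La' Lb' left.target.Comp_assoc eq)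
  then have "Comp D (fobj L Z) Y' ?LR a q = Comp D (fobj L Z) Y' ?LR b q"
    using La' Lb' by simp
  then have "Comp D Y' (fobj L Z) ?LR (Comp D (fobj L Z) Y' ?LR a q) s =
      Comp D Y' (fobj L Z) ?LR (Comp D (fobj L Z) Y' ?LR b q) s" by simp
  then show ?thesis
    using Y Y' Z a b q s by (simp add: left.target.Comp_assoc[symmetric] qs)
qed

text \<open>The transpose of \<open>q\<close> provides a section \<open>u\<close> of the counit, and
  a monomorphism with a section is invertible.\<close>

lemma (in adjoint_functors) counit_iso_of_retract_cofull:
  assumes cofull: "retract_cofull C D L" and Y: "Y \<in> Obj D"
  shows "is_iso D (fobj L (fobj R Y)) Y (\<epsilon> Y)"
proof -
  let ?LR = "fobj L (fobj R Y)"
  obtain Z q s where Z: "Z \<in> Obj C" and q: "q \<in> Hom D (fobj L Z) Y" and s: "s \<in> Hom D Y (fobj L Z)"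
    and qs: "Comp D Y (fobj L Z) Y q s = Ident D Y"
    using assms unfolding retract_cofull_def by meson
  obtain h where h: "h \<in> Hom C Z (fobj R Y)"
    and \<epsilon>h: "Comp D (fobj L Z) ?LR Y (\<epsilon> Y) (fmor L Z (fobj R Y) h) = q"
    using counit_lift[OF Z Y q] .
  define u where "u = Comp D Y (fobj L Z) ?LR (fmor L Z (fobj R Y) h) s"
  have u: "u \<in> Hom D Y ?LR" using Y Z h s by (simp add: u_def)
  have \<epsilon>u: "Comp D Y ?LR Y (\<epsilon> Y) u = Ident D Y"
    using Y Z h s by (simp add: u_def left.target.Comp_assoc \<epsilon>h qs)
  have "Comp D ?LR Y ?LR u (\<epsilon> Y) = Ident D ?LR"
    using Y u by - (rule counit_mono_of_retract_cofull[OF cofull, of Y ?LR],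
      simp_all add: left.target.Comp_assoc \<epsilon>u)
  with u \<epsilon>u Y show ?thesis by (auto simp: is_iso_def)
qed

lemma reflection_of_retract_full:
  assumes "has_right_adjoint C D F" and "retract_full C D F \<or> retract_cofull C D F"
  shows "reflection C D F"
proof -
  obtain R \<eta> \<epsilon> where "adjunction C D F R \<eta> \<epsilon>"
    using assms(1) by (auto simp: has_right_adjoint_def is_left_adjoint_of_def)
  then interpret adjoint_functors C D F R \<eta> \<epsilon>
    by (rule adjoint_functors_of_adjunction)
  show ?thesis
    using assms(2)
  proof
    assume "retract_full C D F"
    then show ?thesis by (intro reflection_of_counit_iso counit_iso_of_retract_full)
  next
    assume "retract_cofull C D F"
    then show ?thesis by (intro reflection_of_counit_iso counit_iso_of_retract_cofull)
  qed
qed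

lemma coreflection_of_retract_full:
  assumes "has_left_adjoint C D F" and "retract_full C D F \<or> retract_cofull C D F"
  shows "coreflection C D F"
  using coreflection_op[OF reflection_of_retract_full[OF has_right_adjoint_op[OF assms(1)]]] assms(2)
  by (auto simp: retract_full_op retract_cofull_op)

section \<open>Bireflections\<close>

text \<open>In a bireflection \<open>i = \<epsilon>l \<circ> \<eta>r\<close> factors through the adjoint, so that the functor is faithful
  modulo \<open>i\<close>. Naturality and idempotence of \<open>i\<close> are consequences.\<close>

definition split_full ::
  "('o, 'm) cat \<Rightarrow> ('p, 'n) cat \<Rightarrow> ('o, 'm, 'p, 'n) func \<Rightarrow> ('o \<Rightarrow> 'm) \<Rightarrow> bool" where
  "split_full C D F i \<longleftrightarrow>
    (\<forall>X\<in>Obj C. i X \<in> Hom C X X \<and> fmor F X X (i X) = Ident D (fobj F X)) \<and>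
    (\<forall>X\<in>Obj C. \<forall>Y\<in>Obj C. \<forall>f\<in>Hom C X Y. \<forall>f'\<in>Hom C X Y. fmor F X Y f = fmor F X Y f' \<longrightarrow>
      Comp C X X Y f (i X) = Comp C X X Y f' (i X) \<and>
      Comp C X Y Y (i Y) f = Comp C X Y Y (i Y) f') \<and>
    (\<forall>X\<in>Obj C. \<forall>Y\<in>Obj C. \<forall>g\<in>Hom D (fobj F X) (fobj F Y). \<exists>f\<in>Hom C X Y. fmor F X Y f = g)"

text \<open>The two cancellation conditions, with \<open>i\<close> on the right and on the left, are
  exchanged.\<close>

lemma split_full_op:
  "split_full C D F i \<Longrightarrow> split_full (op_cat C) (op_cat D) (op_func F) i"
  unfolding split_full_def op_cat_simps op_func_simps by blast

lemma split_full_of_bireflection: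
  assumes "bireflection C D F"
  obtains i where "split_full C D F i"
proof -
  obtain G \<eta>l \<epsilon>l \<eta>r \<epsilon>r where adjl: "adjunction D C G F \<eta>l \<epsilon>l" and adjr: "adjunction C D F G \<eta>r \<epsilon>r"
    and split: "\<And>X. X \<in> Obj C \<Longrightarrow> Comp C (fobj G (fobj F X)) X (fobj G (fobj F X)) (\<eta>r X) (\<epsilon>l X)
      = Ident C (fobj G (fobj F X))"
    using assms unfolding bireflection_def by blast
  interpret l: adjoint_functors D C G F \<eta>l \<epsilon>l
    using adjl by (rule adjoint_functors_of_adjunction)
  interpret r: adjoint_functors C D F G \<eta>r \<epsilon>r
    using adjr by (rule adjoint_functors_of_adjunction)
  \<comment> \<open>Both sides have the identity as transpose under \<open>F\<close>,
    \<open>G\<close>: the left one by naturality of \<open>\<eta>r\<close> and the splitting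
    condition, the right one by a triangle identity.\<close>
  have counits: "fmor F (fobj G (fobj F X)) X (\<epsilon>l X) = \<epsilon>r (fobj F X)" if X: "X \<in> Obj C" for X
    using X r.unit_natural[of "fobj G (fobj F X)" X "\<epsilon>l X"]
    by - (rule r.unit_cancel[of "fobj G (fobj F X)" "fobj F X"], simp_all add: split)
  define i where "i X = Comp C X (fobj G (fobj F X)) X (\<epsilon>l X) (\<eta>r X)" for X
  have "i X \<in> Hom C X X \<and> fmor F X X (i X) = Ident D (fobj F X)" if "X \<in> Obj C" for X
    using that by (simp add: i_def l.right.fmor_Comp counits)
  moreover have "Comp C X X Y f (i X) = Comp C X X Y f' (i X) \<and>
      Comp C X Y Y (i Y) f = Comp C X Y Y (i Y) f'"
    if X: "X \<in> Obj C" and Y: "Y \<in> Obj C" and f: "f \<in> Hom C X Y" and f': "f' \<in> Hom C X Y"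
      and eq: "fmor F X Y f = fmor F X Y f'" for X Y f f'
  proof
    \<comment> \<open>Naturality of \<open>\<epsilon>l\<close> moves \<open>k\<close> to the middle
      as \<open>G F k\<close>, so the composite depends only on \<open>F k\<close>. For
      \<open>i\<close> on the other side the same is done with \<open>\<eta>r\<close>.\<close>
    have *: "Comp C X X Y k (i X) = Comp C X (fobj G (fobj F X)) Y
        (Comp C (fobj G (fobj F X)) (fobj G (fobj F Y)) Y (\<epsilon>l Y)
          (fmor G (fobj F X) (fobj F Y) (fmor F X Y k))) (\<eta>r X)"
      if "k \<in> Hom C X Y" for k
      using X Y that by (simp add: i_def l.counit_natural l.left.target.Comp_assoc)
    show "Comp C X X Y f (i X) = Comp C X X Y f' (i X)"
      by (simp only: *[OF f] *[OF f'] eq)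
    have *: "Comp C X Y Y (i Y) k = Comp C X (fobj G (fobj F Y)) Y (\<epsilon>l Y)
        (Comp C X (fobj G (fobj F X)) (fobj G (fobj F Y))
          (fmor G (fobj F X) (fobj F Y) (fmor F X Y k)) (\<eta>r X))"
      if "k \<in> Hom C X Y" for k
      using X Y that by (simp add: i_def r.unit_natural[symmetric] l.left.target.Comp_assoc)
    show "Comp C X Y Y (i Y) f = Comp C X Y Y (i Y) f'"
      by (simp only: *[OF f] *[OF f'] eq)
  qed
  moreover have "\<exists>f\<in>Hom C X Y. fmor F X Y f = g"
    if X: "X \<in> Obj C" and Y: "Y \<in> Obj C" and g: "g \<in> Hom D (fobj F X) (fobj F Y)" for X Y g
  proof
    let ?Gg = "fmor G (fobj F X) (fobj F Y) g"
    let ?f = "Comp C X (fobj G (fobj F X)) Y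
      (Comp C (fobj G (fobj F X)) (fobj G (fobj F Y)) Y (\<epsilon>l Y) ?Gg) (\<eta>r X)"
    show "?f \<in> Hom C X Y" using X Y g by simp
    have "fmor F X Y ?f = Comp D (fobj F X) (fobj F (fobj G (fobj F X))) (fobj F Y)
        (Comp D (fobj F (fobj G (fobj F X))) (fobj F X) (fobj F Y) g (\<epsilon>r (fobj F X)))
        (fmor F X (fobj G (fobj F X)) (\<eta>r X))"
      using X Y g by (simp add: l.right.fmor_Comp counits r.counit_natural)
    also have "\<dots> = g"
      using X Y g by (simp add: l.left.source.Comp_assoc[symmetric])
    finally show "fmor F X Y ?f = g" .
  qed
  ultimately have "split_full C D F i"
    unfolding split_full_def by blast
  then show thesis by (rule that)
qed

lemma bireflection_of_reflection:
  assumes "reflection C D F" and "split_full C D F i"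
  shows "bireflection C D F"
proof -
  obtain R \<eta> \<epsilon> where ff: "fully_faithful D C R" and adj: "adjunction C D F R \<eta> \<epsilon>"
    using assms(1) by (auto simp: reflection_def is_left_adjoint_of_def)
  interpret adjoint_functors C D F R \<eta> \<epsilon>
    using adj by (rule adjoint_functors_of_adjunction)
  have i: "i X \<in> Hom C X X" and Fi: "fmor F X X (i X) = Ident D (fobj F X)" if "X \<in> Obj C" for X
    using assms(2) that unfolding split_full_def by blast+
  have faithful: "Comp C X X Y f (i X) = Comp C X X Y f' (i X)"
      "Comp C X Y Y (i Y) f = Comp C X Y Y (i Y) f'"
    if "X \<in> Obj C" "Y \<in> Obj C" "f \<in> Hom C X Y" "f' \<in> Hom C X Y" "fmor F X Y f = fmor F X Y f'"
    for X Y f f'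
    using assms(2) that unfolding split_full_def by blast+
  have full: "\<exists>f\<in>Hom C X Y. fmor F X Y f = g"
    if "X \<in> Obj C" "Y \<in> Obj C" "g \<in> Hom D (fobj F X) (fobj F Y)" for X Y g
    using assms(2) that unfolding split_full_def by blast
  \<comment> \<open>\<open>F\<close> sends both \<open>i X\<close> and the identity to the identity,
    so they agree after composition with \<open>i X\<close>.\<close>
  have ii: "Comp C X X X (i X) (i X) = i X" if "X \<in> Obj C" for X
    using faithful(2)[of X X "i X" "Ident C X"] that i Fi by simp
  have i_natural: "Comp C X Y Y (i Y) f = Comp C X X Y f (i X)"
    if X: "X \<in> Obj C" and Y: "Y \<in> Obj C" and f: "f \<in> Hom C X Y" for X Y f
  proof -
    have "Comp C X X Y f (i X) = Comp C X X Y (Comp C X Y Y (i Y) f) (i X)"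
      using X Y f i Fi by - (rule faithful(1), simp_all add: left.fmor_Comp)
    also have "\<dots> = Comp C X Y Y (i Y) (Comp C X X Y f (i X))"
      using X Y f i by (simp add: left.source.Comp_assoc)
    also have "\<dots> = Comp C X Y Y (i Y) f"
      using X Y f i Fi by - (rule faithful(2), simp_all add: left.fmor_Comp)
    finally show ?thesis by simp
  qed
  let ?RF = "\<lambda>X. fobj R (fobj F X)"
  have "\<exists>j\<in>Hom C (?RF X) X. fmor F (?RF X) X j = \<epsilon> (fobj F X) \<and> Comp C (?RF X) X X (i X) j = j"
    if X: "X \<in> Obj C" for X
  proof -
    obtain k where k: "k \<in> Hom C (?RF X) X" and Fk: "fmor F (?RF X) X k = \<epsilon> (fobj F X)"
      using full[of "?RF X" X "\<epsilon> (fobj F X)"] X by auto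
    \<comment> \<open>Composing a lift \<open>k\<close> with \<open>i X\<close> does not change its
      image under \<open>F\<close>, and idempotence of \<open>i X\<close> makes the new lift absorb
      \<open>i X\<close>.\<close>
    show ?thesis
      using X k i by (intro bexI[of _ "Comp C (?RF X) X X (i X) k"])
        (simp_all add: left.fmor_Comp Fi Fk left.source.Comp_assoc ii)
  qed
  then obtain j where j: "\<And>X. X \<in> Obj C \<Longrightarrow> j X \<in> Hom C (?RF X) X"
    and Fj: "\<And>X. X \<in> Obj C \<Longrightarrow> fmor F (?RF X) X (j X) = \<epsilon> (fobj F X)"
    and ij: "\<And>X. X \<in> Obj C \<Longrightarrow> Comp C (?RF X) X X (i X) (j X) = j X"
    by metis
  \<comment> \<open>This is the splitting condition of a bireflection; both sides have transpose
    \<open>\<epsilon> (fobj F X)\<close>.\<close>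
  have \<eta>j: "Comp C (?RF X) X (?RF X) (\<eta> X) (j X) = Ident C (?RF X)" if X: "X \<in> Obj C" for X
    using X j[OF X] by - (rule counit_cancel[of "?RF X" "fobj F X"],
      simp_all add: left.fmor_Comp left.target.Comp_assoc Fj)
  \<comment> \<open>Both sides have the same image under \<open>F\<close> because
    \<open>\<epsilon>\<close> is natural, so they agree after \<open>i Y\<close>; each of them
    absorbs \<open>i Y\<close>.\<close>
  have j_natural: "Comp C (?RF X) (?RF Y) Y (j Y)
      (fmor R (fobj F X) (fobj F Y) (fmor F X Y f)) = Comp C (?RF X) X Y f (j X)"
    if X: "X \<in> Obj C" and Y: "Y \<in> Obj C" and f: "f \<in> Hom C X Y" for X Y f
  proof -
    let ?RFf = "fmor R (fobj F X) (fobj F Y) (fmor F X Y f)"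
    have "Comp C (?RF X) X Y f (j X) = Comp C (?RF X) Y Y (i Y) (Comp C (?RF X) X Y f (j X))"
      using X Y f i j by (simp add: left.source.Comp_assoc i_natural)
        (simp add: left.source.Comp_assoc[symmetric] ij)
    also have "\<dots> = Comp C (?RF X) Y Y (i Y) (Comp C (?RF X) (?RF Y) Y (j Y) ?RFf)"
      using X Y f j by - (rule faithful(2), simp_all add: left.fmor_Comp Fj counit_natural)
    also have "\<dots> = Comp C (?RF X) (?RF Y) Y (j Y) ?RFf"
      using X Y f i j by (simp add: left.source.Comp_assoc ij)
    finally show ?thesis by simp
  qed
  have "nat_iso D D (comp_func F R) id_func \<epsilon>"
    using adj counit_iso[OF ff] by (simp add: nat_iso_def adjunction_def)
  then obtain u where u_nat_iso: "nat_iso D D id_func (comp_func F R) u"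
    and u\<epsilon>: "\<And>Y. Y \<in> Obj D \<Longrightarrow>
      Comp D (fobj F (fobj R Y)) Y (fobj F (fobj R Y)) (u Y) (\<epsilon> Y) = Ident D (fobj F (fobj R Y))"
    and \<epsilon>u: "\<And>Y. Y \<in> Obj D \<Longrightarrow> Comp D Y (fobj F (fobj R Y)) Y (\<epsilon> Y) (u Y) = Ident D Y"
    by (rule nat_iso_inverse) simp
  have u: "u Y \<in> Hom D Y (fobj F (fobj R Y))" if "Y \<in> Obj D" for Y
    using u_nat_iso that by (simp add: nat_iso_def nat_trans_def)
  \<comment> \<open>The unit of the new adjunction is the inverse \<open>u\<close> of
    \<open>\<epsilon>\<close>. After transposing, naturality of \<open>\<epsilon>\<close> at
    \<open>u Y\<close> reduces the identity to \<open>u\<epsilon>\<close>.\<close>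
  have triangle: "Comp C (fobj R Y) (?RF (fobj R Y)) (fobj R Y) (j (fobj R Y))
      (fmor R Y (fobj F (fobj R Y)) (u Y)) = Ident C (fobj R Y)" if Y: "Y \<in> Obj D" for Y
    using Y u[OF Y] j
    by - (rule counit_cancel[of "fobj R Y" Y],
      simp_all add: left.fmor_Comp Fj counit_natural u\<epsilon>)
  have "adjunction D C R F u j"
    unfolding adjunction_def
    using u_nat_iso left.cat_functor_axioms right.cat_functor_axioms j triangle
    by (simp add: nat_iso_def nat_trans_def j_natural Fj \<epsilon>u cat_functor_id_func cat_functor_comp_func
        left.source.category_axioms)
  then show ?thesis
    unfolding bireflection_def using ff adj left.cat_functor_axioms \<eta>j by blast
qed

lemma bireflection_of_coreflection:
  assumes "coreflection C D F" and "split_full C D F i"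
  shows "bireflection C D F"
  using bireflection_op[OF bireflection_of_reflection[OF reflection_op[OF assms(1)]
      split_full_op[OF assms(2)]]] by simp

section \<open>Equivalences\<close>

text \<open>Passing to opposites reverses \<open>\<alpha>\<close> and \<open>\<beta>\<close>, hence
  their inverses are used.\<close>

lemma equivalence_op:
  assumes "equivalence C D F"
  shows "equivalence (op_cat C) (op_cat D) (op_func F)"
proof -
  obtain G \<alpha> \<beta> where F: "cat_functor C D F" and G: "cat_functor D C G"
    and \<alpha>: "nat_iso C C id_func (comp_func G F) \<alpha>" and \<beta>: "nat_iso D D (comp_func F G) id_func \<beta>"
    using assms unfolding equivalence_def by blast
  obtain \<alpha>' where \<alpha>': "nat_iso C C (comp_func G F) id_func \<alpha>'"
    using \<alpha> by (rule nat_iso_inverse)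
  obtain \<beta>' where \<beta>': "nat_iso D D id_func (comp_func F G) \<beta>'"
    using \<beta> by (rule nat_iso_inverse)
  have "nat_iso (op_cat C) (op_cat C) id_func (comp_func (op_func G) (op_func F)) \<alpha>'"
    "nat_iso (op_cat D) (op_cat D) (comp_func (op_func F) (op_func G)) id_func \<beta>'"
    using \<alpha>' \<beta>' nat_trans_op[of C C "comp_func G F" id_func \<alpha>']
      nat_trans_op[of D D id_func "comp_func F G" \<beta>']
    by (simp_all add: nat_iso_def op_id_func op_comp_func)
  then show ?thesis
    unfolding equivalence_def using cat_functor_op[OF F] cat_functor_op[OF G] by blast
qed

text \<open>Naturality expresses \<open>\<alpha> Y\<close> after \<open>k\<close> through
  \<open>F k\<close>, and a left inverse of \<open>\<alpha> Y\<close> recovers \<open>k\<close>.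
  Only one half of an equivalence is assumed, so the lemma applies to either of the two
  functors.\<close>

lemma nat_iso_id_faithful:
  assumes F: "cat_functor C D F" and G: "cat_functor D C G"
    and \<alpha>: "nat_iso C C id_func (comp_func G F) \<alpha>"
    and X: "X \<in> Obj C" and Y: "Y \<in> Obj C" and f: "f \<in> Hom C X Y" and f': "f' \<in> Hom C X Y"
    and eq: "fmor F X Y f = fmor F X Y f'"
  shows "f = f'"
proof -
  interpret F: cat_functor C D F by fact
  interpret G: cat_functor D C G by fact
  let ?GF = "\<lambda>X. fobj G (fobj F X)"
  have \<alpha>_Hom: "\<alpha> X \<in> Hom C X (?GF X)" if "X \<in> Obj C" for X
    using \<alpha> that by (simp add: nat_iso_def nat_trans_def)
  have nat: "Comp C X Y (?GF Y) (\<alpha> Y) k = Comp C X (?GF X) (?GF Y)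
      (fmor G (fobj F X) (fobj F Y) (fmor F X Y k)) (\<alpha> X)" if "k \<in> Hom C X Y" for k
    using \<alpha> X Y that by (simp add: nat_iso_def nat_trans_def)
  obtain a where a: "a \<in> Hom C (?GF Y) Y" and a\<alpha>: "Comp C Y (?GF Y) Y a (\<alpha> Y) = Ident C Y"
    using \<alpha> Y by (auto simp: nat_iso_def is_iso_def)
  have "Comp C X (?GF Y) Y a (Comp C X Y (?GF Y) (\<alpha> Y) k) = k" if "k \<in> Hom C X Y" for k
    using X Y a that \<alpha>_Hom by (simp add: F.source.Comp_assoc a\<alpha>)
  from this[OF f] this[OF f'] show ?thesis by (simp only: nat[OF f] nat[OF f'] eq)
qed

lemma retract_full_of_full:
  assumes "cat_functor C D F"
    and "\<And>X Y g. \<lbrakk>X \<in> Obj C; Y \<in> Obj C; g \<in> Hom D (fobj F X) (fobj F Y)\<rbrakk>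
      \<Longrightarrow> \<exists>f\<in>Hom C X Y. fmor F X Y f = g"
    and "\<And>Y. Y \<in> Obj D \<Longrightarrow> \<exists>Z\<in>Obj C. \<exists>q. is_iso D (fobj F Z) Y q"
  shows "retract_full C D F"
proof -
  interpret cat_functor C D F by fact
  show ?thesis
    unfolding retract_full_def
  proof
    fix Y assume Y: "Y \<in> Obj D"
    obtain Z q s where Z: "Z \<in> Obj C" and q: "q \<in> Hom D (fobj F Z) Y"
      and s: "s \<in> Hom D Y (fobj F Z)" and qs: "Comp D Y (fobj F Z) Y q s = Ident D Y"
      using assms(3)[OF Y] unfolding is_iso_def by blast
    show "\<exists>Z\<in>Obj C. \<exists>q\<in>Hom D (fobj F Z) Y. \<exists>s\<in>Hom D Y (fobj F Z).
        Comp D Y (fobj F Z) Y q s = Ident D Y \<and>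
        (\<forall>X\<in>Obj C. \<forall>h\<in>Hom D (fobj F X) Y. \<exists>k\<in>Hom C X Z.
          fmor F X Z k = Comp D (fobj F X) Y (fobj F Z) s h)"
      using Y Z q s qs
      by (intro bexI[of _ Z] bexI[of _ q] bexI[of _ s] conjI ballI assms(2)) simp_all
  qed
qed

lemma equivalence_fully_faithful:
  assumes "equivalence C D F"
  shows "fully_faithful C D F" and "retract_full C D F"
proof -
  obtain G \<alpha> \<beta> where F: "cat_functor C D F" and G: "cat_functor D C G"
    and \<alpha>: "nat_iso C C id_func (comp_func G F) \<alpha>" and \<beta>: "nat_iso D D (comp_func F G) id_func \<beta>"
    using assms unfolding equivalence_def by blast
  interpret F: cat_functor C D F by fact
  interpret G: cat_functor D C G by fact
  let ?GF = "\<lambda>X. fobj G (fobj F X)"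
  obtain \<beta>' where \<beta>': "nat_iso D D id_func (comp_func F G) \<beta>'"
    using \<beta> by (rule nat_iso_inverse)
  have \<alpha>_Hom: "\<alpha> X \<in> Hom C X (?GF X)" if "X \<in> Obj C" for X
    using \<alpha> that by (simp add: nat_iso_def nat_trans_def)
  obtain \<sigma> where \<sigma>: "nat_iso C C (comp_func G F) id_func \<sigma>"
    and \<alpha>\<sigma>: "\<And>X. X \<in> Obj C \<Longrightarrow> Comp C (?GF X) X (?GF X) (\<alpha> X) (\<sigma> X) = Ident C (?GF X)"
    using \<alpha> by (rule nat_iso_inverse) simp
  have \<sigma>_Hom: "\<sigma> X \<in> Hom C (?GF X) X" if "X \<in> Obj C" for X
    using \<sigma> that by (simp add: nat_iso_def nat_trans_def)
  have full: "\<exists>f\<in>Hom C X Y. fmor F X Y f = g"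
    if X: "X \<in> Obj C" and Y: "Y \<in> Obj C" and g: "g \<in> Hom D (fobj F X) (fobj F Y)" for X Y g
  proof -
    define Gg where "Gg = fmor G (fobj F X) (fobj F Y) g"
    have Gg: "Gg \<in> Hom C (?GF X) (?GF Y)" using X Y g by (simp add: Gg_def)
    \<comment> \<open>\<open>f\<close> is \<open>G g\<close> conjugated by \<open>\<alpha>\<close>.
      Naturality gives \<open>G F f = G g\<close>, and \<open>G\<close> is faithful by way of
      \<open>\<beta>'\<close>.\<close>
    define f where "f = Comp C X (?GF Y) Y (\<sigma> Y) (Comp C X (?GF X) (?GF Y) Gg (\<alpha> X))"
    have f: "f \<in> Hom C X Y" using X Y Gg \<alpha>_Hom \<sigma>_Hom by (simp add: f_def)
    define GFf where "GFf = fmor G (fobj F X) (fobj F Y) (fmor F X Y f)"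
    have GFf: "GFf \<in> Hom C (?GF X) (?GF Y)" using X Y f by (simp add: GFf_def)
    have "Comp C X (?GF X) (?GF Y) GFf (\<alpha> X) = Comp C X Y (?GF Y) (\<alpha> Y) f"
      using \<alpha> X Y f by (simp add: nat_iso_def nat_trans_def GFf_def)
    also have "\<dots> = Comp C X (?GF X) (?GF Y) Gg (\<alpha> X)"
      using X Y Gg \<alpha>_Hom \<sigma>_Hom by (simp add: f_def F.source.Comp_assoc \<alpha>\<sigma>)
    finally have "Comp C (?GF X) X (?GF Y) (Comp C X (?GF X) (?GF Y) GFf (\<alpha> X)) (\<sigma> X) =
        Comp C (?GF X) X (?GF Y) (Comp C X (?GF X) (?GF Y) Gg (\<alpha> X)) (\<sigma> X)"
      by simp
    then have "GFf = Gg"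
      using X Y Gg GFf \<alpha>_Hom \<sigma>_Hom by (simp add: F.source.Comp_assoc[symmetric] \<alpha>\<sigma>)
    then have "fmor F X Y f = g"
      using X Y f g by - (rule nat_iso_id_faithful[OF G F \<beta>', of "fobj F X" "fobj F Y"],
        simp_all add: Gg_def GFf_def)
    then show ?thesis using f by blast
  qed
  show "fully_faithful C D F"
    unfolding fully_faithful_def
  proof (intro conjI ballI F)
    fix X Y assume X: "X \<in> Obj C" and Y: "Y \<in> Obj C"
    have "inj_on (fmor F X Y) (Hom C X Y)"
      using nat_iso_id_faithful[OF F G \<alpha> X Y] by (intro inj_onI)
    moreover have "fmor F X Y ` Hom C X Y = Hom D (fobj F X) (fobj F Y)"
      using full[OF X Y] F.fmor_in_Hom[OF X Y] by (fastforce simp: image_iff)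
    ultimately show "bij_betw (fmor F X Y) (Hom C X Y) (Hom D (fobj F X) (fobj F Y))"
      by (simp add: bij_betw_def)
  qed
  have "\<exists>Z\<in>Obj C. \<exists>q. is_iso D (fobj F Z) Y q" if "Y \<in> Obj D" for Y
    using \<beta> that by (intro bexI[of _ "fobj G Y"] exI[of _ "\<beta> Y"]) (simp_all add: nat_iso_def)
  then show "retract_full C D F"
    using F full by (intro retract_full_of_full)
qed

lemma retract_cofull_of_equivalence: "equivalence C D F \<Longrightarrow> retract_cofull C D F"
  using equivalence_fully_faithful(2)[OF equivalence_op] by (simp add: retract_full_op)

text \<open>Unit and counit themselves witness the equivalence: full faithfulness of
  \<open>F\<close> inverts the unit by the dual of \<open>counit_iso\<close>, and retract fullness
  inverts the counit.\<close>

lemma equivalence_of_right_adjoint: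
  assumes ff: "fully_faithful C D F" and "retract_full C D F" and "has_right_adjoint C D F"
  shows "equivalence C D F"
proof -
  obtain R \<eta> \<epsilon> where adj: "adjunction C D F R \<eta> \<epsilon>"
    using assms(3) by (auto simp: has_right_adjoint_def is_left_adjoint_of_def)
  then interpret adjoint_functors C D F R \<eta> \<epsilon>
    by (rule adjoint_functors_of_adjunction)
  interpret op: adjoint_functors "op_cat D" "op_cat C" "op_func R" "op_func F" \<epsilon> \<eta>
    by (rule adjoint_functors_op) (rule adjoint_functors_axioms)
  have "nat_iso C C id_func (comp_func R F) \<eta>"
    using adj op.counit_iso[OF fully_faithful_op[OF ff]] by (simp add: nat_iso_def adjunction_def)
  moreover have "nat_iso D D (comp_func F R) id_func \<epsilon>"
    using adj counit_iso_of_retract_full[OF assms(2)] by (simp add: nat_iso_def adjunction_def)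
  ultimately show ?thesis
    unfolding equivalence_def using left.cat_functor_axioms right.cat_functor_axioms by blast
qed

lemma equivalence_of_left_adjoint:
  assumes "fully_faithful C D F" and "retract_cofull C D F" and "has_left_adjoint C D F"
  shows "equivalence C D F"
  using equivalence_op[OF equivalence_of_right_adjoint[OF fully_faithful_op[OF assms(1)] _
      has_right_adjoint_op[OF assms(3)]]] assms(2)
  by (simp add: retract_full_op)

section \<open>Restriction along the embedding into the idempotent completion\<close>

lemma idem_completion_simps [simp]:
  "(X, e) \<in> Obj (idem_completion C) \<longleftrightarrow>
    X \<in> Obj C \<and> e \<in> Hom C X X \<and> Comp C X X X e e = e"
  "Comp (idem_completion C) (X, e) (Y, e') (Z, e'') g f = Comp C X Y Z g f"
  "Ident (idem_completion C) (X, e) = e"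
  by (simp_all add: idem_completion_def)

lemma func_completion_simps [simp]:
  "fobj (func_completion F) (X, e) = (fobj F X, fmor F X X e)"
  "fmor (func_completion F) (X, e) (Y, e') f = fmor F X Y f"
  by (simp_all add: func_completion_def)

lemma idem_completion_Hom_subset:
  "f \<in> Hom (idem_completion C) (X, e) (Y, e') \<Longrightarrow> f \<in> Hom C X Y"
  by (simp add: idem_completion_def)

text \<open>The embedding of \<open>C\<close> by \<open>X\<close> to \<open>(X, Ident C X)\<close>
  is fully faithful, with the identity as action on morphisms.\<close>

lemma (in category) idem_completion_Hom_Ident [simp]:
  "\<lbrakk>X \<in> Obj C; Y \<in> Obj C\<rbrakk> \<Longrightarrow>
    Hom (idem_completion C) (X, Ident C X) (Y, Ident C Y) = Hom C X Y"
  by (auto simp: idem_completion_def)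

context cat_functor
begin

text \<open>A retraction of \<open>F\<^sup>\<natural> (Z, e)\<close> onto
  \<open>(Y, Ident D Y)\<close> is also a retraction of \<open>fobj F Z\<close> onto
  \<open>Y\<close> once \<open>e\<close> is forgotten, since composition is that of
  \<open>D\<close>. The lifts are found by testing on objects \<open>(X, Ident C X)\<close>.\<close>

lemma retract_full_of_completion:
  assumes "retract_full (idem_completion C) (idem_completion D) (func_completion F)"
  shows "retract_full C D F"
  unfolding retract_full_def
proof
  fix Y assume Y: "Y \<in> Obj D"
  then have Y': "(Y, Ident D Y) \<in> Obj (idem_completion D)" by simp
  obtain Z e q s where Z: "(Z, e) \<in> Obj (idem_completion C)"
    and q: "q \<in> Hom (idem_completion D) (fobj (func_completion F) (Z, e)) (Y, Ident D Y)"
    and s: "s \<in> Hom (idem_completion D) (Y, Ident D Y) (fobj (func_completion F) (Z, e))"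
    and qs: "Comp (idem_completion D) (Y, Ident D Y) (fobj (func_completion F) (Z, e)) (Y, Ident D Y)
      q s = Ident (idem_completion D) (Y, Ident D Y)"
    and full: "\<And>X h. \<lbrakk>X \<in> Obj (idem_completion C);
      h \<in> Hom (idem_completion D) (fobj (func_completion F) X) (Y, Ident D Y)\<rbrakk> \<Longrightarrow>
      \<exists>k\<in>Hom (idem_completion C) X (Z, e). fmor (func_completion F) X (Z, e) k =
        Comp (idem_completion D) (fobj (func_completion F) X) (Y, Ident D Y)
          (fobj (func_completion F) (Z, e)) s h"
    using bspec[OF assms[unfolded retract_full_def] Y'] by (metis surj_pair)
  have "\<exists>k\<in>Hom C X Z. fmor F X Z k = Comp D (fobj F X) Y (fobj F Z) s h"
    if X: "X \<in> Obj C" and h: "h \<in> Hom D (fobj F X) Y" for X h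
    using full[of "(X, Ident C X)" h] X Y h by (auto dest: idem_completion_Hom_subset)
  then show "\<exists>Z\<in>Obj C. \<exists>q\<in>Hom D (fobj F Z) Y. \<exists>s\<in>Hom D Y (fobj F Z).
      Comp D Y (fobj F Z) Y q s = Ident D Y \<and>
      (\<forall>X\<in>Obj C. \<forall>h\<in>Hom D (fobj F X) Y. \<exists>k\<in>Hom C X Z.
        fmor F X Z k = Comp D (fobj F X) Y (fobj F Z) s h)"
    using Z q s qs
    by (intro bexI[of _ Z] bexI[of _ q] bexI[of _ s]) (auto dest: idem_completion_Hom_subset)
qed

lemma retract_cofull_of_completion:
  assumes "retract_cofull (idem_completion C) (idem_completion D) (func_completion F)"
  shows "retract_cofull C D F"
  unfolding retract_cofull_def
proof
  fix Y assume Y: "Y \<in> Obj D"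
  then have Y': "(Y, Ident D Y) \<in> Obj (idem_completion D)" by simp
  obtain Z e q s where Z: "(Z, e) \<in> Obj (idem_completion C)"
    and q: "q \<in> Hom (idem_completion D) (fobj (func_completion F) (Z, e)) (Y, Ident D Y)"
    and s: "s \<in> Hom (idem_completion D) (Y, Ident D Y) (fobj (func_completion F) (Z, e))"
    and qs: "Comp (idem_completion D) (Y, Ident D Y) (fobj (func_completion F) (Z, e)) (Y, Ident D Y)
      q s = Ident (idem_completion D) (Y, Ident D Y)"
    and full: "\<And>X h. \<lbrakk>X \<in> Obj (idem_completion C);
      h \<in> Hom (idem_completion D) (Y, Ident D Y) (fobj (func_completion F) X)\<rbrakk> \<Longrightarrow>
      \<exists>k\<in>Hom (idem_completion C) (Z, e) X. fmor (func_completion F) (Z, e) X k =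
        Comp (idem_completion D) (fobj (func_completion F) (Z, e)) (Y, Ident D Y)
          (fobj (func_completion F) X) h q"
    using bspec[OF assms[unfolded retract_cofull_def] Y'] by (metis surj_pair)
  have "\<exists>k\<in>Hom C Z X. fmor F Z X k = Comp D (fobj F Z) Y (fobj F X) h q"
    if X: "X \<in> Obj C" and h: "h \<in> Hom D Y (fobj F X)" for X h
    using full[of "(X, Ident C X)" h] X Y h by (auto dest: idem_completion_Hom_subset)
  then show "\<exists>Z\<in>Obj C. \<exists>q\<in>Hom D (fobj F Z) Y. \<exists>s\<in>Hom D Y (fobj F Z).
      Comp D Y (fobj F Z) Y q s = Ident D Y \<and>
      (\<forall>X\<in>Obj C. \<forall>h\<in>Hom D Y (fobj F X). \<exists>k\<in>Hom C Z X.
        fmor F Z X k = Comp D (fobj F Z) Y (fobj F X) h q)"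
    using Z q s qs
    by (intro bexI[of _ Z] bexI[of _ q] bexI[of _ s]) (auto dest: idem_completion_Hom_subset)
qed

lemma split_full_of_completion:
  assumes "split_full (idem_completion C) (idem_completion D) (func_completion F) i"
  shows "split_full C D F (\<lambda>X. i (X, Ident C X))"
proof -
  let ?e = "\<lambda>X. (X, Ident C X)"
  have i: "i X \<in> Hom (idem_completion C) X X \<and>
      fmor (func_completion F) X X (i X) = Ident (idem_completion D) (fobj (func_completion F) X)"
    if "X \<in> Obj (idem_completion C)" for X
    using assms that unfolding split_full_def by blast
  have faithful: "Comp (idem_completion C) X X Y f (i X) = Comp (idem_completion C) X X Y f' (i X) \<and>
      Comp (idem_completion C) X Y Y (i Y) f = Comp (idem_completion C) X Y Y (i Y) f'"
    if "X \<in> Obj (idem_completion C)" "Y \<in> Obj (idem_completion C)"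
      "f \<in> Hom (idem_completion C) X Y" "f' \<in> Hom (idem_completion C) X Y"
      "fmor (func_completion F) X Y f = fmor (func_completion F) X Y f'" for X Y f f'
    using assms that unfolding split_full_def by blast
  have full: "\<exists>f\<in>Hom (idem_completion C) X Y. fmor (func_completion F) X Y f = g"
    if "X \<in> Obj (idem_completion C)" "Y \<in> Obj (idem_completion C)"
      "g \<in> Hom (idem_completion D) (fobj (func_completion F) X) (fobj (func_completion F) Y)"
    for X Y g
    using assms that unfolding split_full_def by blast
  have "i (?e X) \<in> Hom C X X \<and> fmor F X X (i (?e X)) = Ident D (fobj F X)" if "X \<in> Obj C" for X
    using i[of "?e X"] that by simp
  moreover have "Comp C X X Y f (i (?e X)) = Comp C X X Y f' (i (?e X)) \<and>
      Comp C X Y Y (i (?e Y)) f = Comp C X Y Y (i (?e Y)) f'"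
    if "X \<in> Obj C" "Y \<in> Obj C" "f \<in> Hom C X Y" "f' \<in> Hom C X Y" "fmor F X Y f = fmor F X Y f'"
    for X Y f f'
    using faithful[of "?e X" "?e Y" f f'] that by simp
  moreover have "\<exists>f\<in>Hom C X Y. fmor F X Y f = g"
    if "X \<in> Obj C" "Y \<in> Obj C" "g \<in> Hom D (fobj F X) (fobj F Y)" for X Y g
    using full[of "?e X" "?e Y" g] that by simp
  ultimately show ?thesis unfolding split_full_def by blast
qed

lemma fully_faithful_of_completion:
  assumes "fully_faithful (idem_completion C) (idem_completion D) (func_completion F)"
  shows "fully_faithful C D F"
  unfolding fully_faithful_def
proof (intro conjI ballI cat_functor_axioms)
  fix X Y assume X: "X \<in> Obj C" and Y: "Y \<in> Obj C"
  let ?X = "(X, Ident C X)" and ?Y = "(Y, Ident C Y)"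
  have X': "?X \<in> Obj (idem_completion C)" "?Y \<in> Obj (idem_completion C)"
    using X Y by simp_all
  have "bij_betw (fmor (func_completion F) ?X ?Y) (Hom (idem_completion C) ?X ?Y)
      (Hom (idem_completion D) (fobj (func_completion F) ?X) (fobj (func_completion F) ?Y))"
    using assms X' unfolding fully_faithful_def by blast
  moreover have "fmor (func_completion F) ?X ?Y = fmor F X Y"
    by (simp add: fun_eq_iff)
  ultimately show "bij_betw (fmor F X Y) (Hom C X Y) (Hom D (fobj F X) (fobj F Y))"
    using X Y by simp
qed

end

section \<open>Deduction of the six assertions\<close>

lemma reflection_of_bireflection:
  "bireflection C D F \<Longrightarrow> reflection C D F"
  unfolding bireflection_def reflection_def is_left_adjoint_of_def by blast

theorem proposition2p9:
  fixes C :: "('o, 'm) cat" and D :: "('p, 'n) cat" and F :: "('o, 'm, 'p, 'n) func"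
  assumes "category C" and "category D" and "cat_functor C D F"
  shows "(coreflection_up_to_retracts C D F \<and> has_left_adjoint C D F \<longrightarrow> coreflection C D F) \<and>
    (coreflection_up_to_retracts C D F \<and> has_right_adjoint C D F \<longrightarrow> reflection C D F) \<and>
    (reflection_up_to_retracts C D F \<and> has_right_adjoint C D F \<longrightarrow> reflection C D F) \<and>
    (reflection_up_to_retracts C D F \<and> has_left_adjoint C D F \<longrightarrow> coreflection C D F) \<and>
    (bireflection_up_to_retracts C D F \<and> (has_left_adjoint C D F \<or> has_right_adjoint C D F)
      \<longrightarrow> bireflection C D F) \<and>
    (equivalence_up_to_retracts C D F \<and> (has_left_adjoint C D F \<or> has_right_adjoint C D F)
      \<longrightarrow> equivalence C D F)"
proof -
  interpret cat_functor C D F by fact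
  have full: "retract_full C D F" if "reflection_up_to_retracts C D F"
    using that unfolding reflection_up_to_retracts_def
    by (intro retract_full_of_completion retract_full_of_reflection)
  have cofull: "retract_cofull C D F" if "coreflection_up_to_retracts C D F"
    using that unfolding coreflection_up_to_retracts_def
    by (intro retract_cofull_of_completion retract_cofull_of_coreflection)
  have bi: "bireflection C D F" if bi: "bireflection_up_to_retracts C D F"
    and adj: "has_left_adjoint C D F \<or> has_right_adjoint C D F"
  proof -
    obtain i where i: "split_full C D F i"
      using bi split_full_of_bireflection split_full_of_completion
      unfolding bireflection_up_to_retracts_def by metis
    \<comment> \<open>A bireflection is in particular a reflection. Retract fullness with either
      adjoint then makes \<open>F\<close> a reflection or a coreflection, which \<open>i\<close>
      upgrades to a bireflection.\<close>
    have "retract_full C D F"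
      using bi full reflection_of_bireflection
      unfolding bireflection_up_to_retracts_def reflection_up_to_retracts_def by blast
    then show ?thesis
      using adj i reflection_of_retract_full coreflection_of_retract_full
        bireflection_of_reflection bireflection_of_coreflection by metis
  qed
  have eq: "equivalence C D F" if eq: "equivalence_up_to_retracts C D F"
    and adj: "has_left_adjoint C D F \<or> has_right_adjoint C D F"
  proof -
    note eq = eq[unfolded equivalence_up_to_retracts_def]
    have ff: "fully_faithful C D F"
      by (rule fully_faithful_of_completion) (rule equivalence_fully_faithful(1)[OF eq])
    have "retract_full C D F"
      by (rule retract_full_of_completion) (rule equivalence_fully_faithful(2)[OF eq])
    moreover have "retract_cofull C D F"
      by (rule retract_cofull_of_completion) (rule retract_cofull_of_equivalence[OF eq])
    \<comment> \<open>A right adjoint is handled through \<open>retract_full\<close>, a left adjoint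
      through \<open>retract_cofull\<close>.\<close>
    ultimately show ?thesis
      using adj ff equivalence_of_right_adjoint equivalence_of_left_adjoint by metis
  qed
  show ?thesis
    using full cofull bi eq reflection_of_retract_full coreflection_of_retract_full by metis
qed

end
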